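(* Every convex body $K\subset\mathbb{R}^2$ satisfies $\mathrm{Sym}_{\mathrm{fold}}(K)\ge 3/8$. There is a sequence of parallelograms $P_j$ with $\mathrm{Sym}_{\mathrm{fold}}(P_j)\to 1/\phi$, where $\phi=\frac{1+\sqrt5}{2}$. Hence $3/8\le\varphi(2)\le 1/\phi$. Furthermore, every centrally symmetric convex body $K\subset\mathbb{R}^2$ satisfies $\mathrm{Sym}_{\mathrm{fold}}(K)\ge 4/9$, i.e. $\varphi_{cs}(2)\ge 4/9$.
   Context: A convex body is a compact convex set with nonempty interior. For a convex body $K\subset\mathbb{R}^n$, the folding symmetry is $$\mathrm{Sym}_{\mathrm{fold}}(K)=\frac{2}{\mathrm{vol}_n(K)}\sup\big\{\mathrm{vol}_n(K\cap\mathcal H):\ \mathcal H \text{ a closed halfspace with } \mathrm{refl}_{\partial\mathcal H}(K\cap\mathcal H)\subset K\big\},$$ where $\mathrm{refl}_{\partial\mathcal H}$ is the orthogonal reflection in the bounding hyperplane of $\mathcal H$. Define $\varphi(n)=\inf\{\mathrm{Sym}_{\mathrm{fold}}(K)\}$ over all convex bodies $K\subset\mathbb{R}^n$, and $\varphi_{cs}(n)$ the same infimum over centrally symmetric convex bodies only. *)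

theory Defs
  imports "HOL-Analysis.Analysis"
begin

definition convex_body :: "'a::euclidean_space set \<Rightarrow> bool" where
  "convex_body K \<longleftrightarrow> compact K \<and> convex K \<and> interior K \<noteq> {}"

definition closed_halfspace :: "'a::euclidean_space \<Rightarrow> real \<Rightarrow> 'a set" where
  "closed_halfspace a b = {x. a \<bullet> x \<le> b}"

definition refl_hyp :: "'a::euclidean_space \<Rightarrow> real \<Rightarrow> 'a \<Rightarrow> 'a" where
  "refl_hyp a b x = x - (2 * (a \<bullet> x - b) / (a \<bullet> a)) *\<^sub>R a"

definition sym_fold :: "'a::euclidean_space set \<Rightarrow> real" where
  "sym_fold K = 2 / measure lebesgue K *
     Sup { measure lebesgue (K \<inter> closed_halfspace a b) | a b.
             a \<noteq> 0 \<and> refl_hyp a b ` (K \<inter> closed_halfspace a b) \<subseteq> K }"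

definition centrally_symmetric :: "'a::euclidean_space set \<Rightarrow> bool" where
  "centrally_symmetric K \<longleftrightarrow> (\<exists>c. \<forall>x\<in>K. 2 *\<^sub>R c - x \<in> K)"

definition phi2 :: real where
  "phi2 = Inf { sym_fold K | K :: (real^2) set. convex_body K }"

definition phi_cs2 :: real where
  "phi_cs2 = Inf { sym_fold K | K :: (real^2) set. convex_body K \<and> centrally_symmetric K }"

definition parallelogram :: "(real^2) set \<Rightarrow> bool" where
  "parallelogram P \<longleftrightarrow> (\<exists>p u v. \<not> collinear {0, u, v} \<and>
     P = {p + s *\<^sub>R u + t *\<^sub>R v | s t. s \<in> {0..1} \<and> t \<in> {0..1}})"

definition golden_ratio :: real where
  "golden_ratio = (1 + sqrt 5) / 2"

end

theory Submission
  imports Defs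
begin

text \<open>Lower bounds. Given \<open>a\<close> less than half the area of \<open>K\<close>, consider the strips between parallel
  lines that cut caps of area \<open>a\<close> off \<open>K\<close> on both sides, and take the widest one. Its two boundary
  chords have their midpoints on a common perpendicular, since otherwise tilting the strip would
  widen it. Hence the cap behind the shorter chord projects into that chord, and its reflection
  stays in the isosceles trapezoid spanned by the two chords as soon as the cap is no higher than the
  strip is wide. The latter follows by dilating the cap from its top point, provided that \<open>a\<close> is at
  most \<open>1/5\<close> of the area of \<open>K\<close>, or at most \<open>2/9\<close> of it if \<open>K\<close> is centrally symmetric.

  Parallelograms. Let the sides be \<open>(1, 0)\<close> and \<open>(\<rho>, \<delta>)\<close> with \<open>\<rho> = \<phi>\<^sup>-\<^sup>2\<close>. In affine coordinates
  this is a square, and a fold is an oblique reflection. The images of the vertices show that a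
  fold cuts off either a quadrilateral orthogonally to the long side, and so at most the fraction
  \<open>(1 - \<rho>)/2 = 1/(2\<phi>)\<close>, or a triangle, whose fraction is at most \<open>1/(2\<phi>)\<close> up to an error \<open>O(\<delta>\<^sup>2)\<close>.\<close>

section \<open>Caps of a given area\<close>

definition cap :: "'a::euclidean_space set \<Rightarrow> 'a \<Rightarrow> real \<Rightarrow> 'a set" where
  "cap K v s = K \<inter> {x. s \<le> v \<bullet> x}"

text \<open>Encoded as a supremum, so that no continuity of the area is needed beforehand. For
  compact \<open>K\<close>, nonzero \<open>v\<close> and \<open>a\<close> strictly between 0 and the
  area of \<open>K\<close> it is the height at which the cap has area exactly \<open>a\<close>. For
  unit \<open>v\<close>, \<open>level K a v + level K a (- v)\<close> is the signed width of the
  strip between the two opposite caps of area \<open>a\<close>.\<close>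

definition level :: "'a::euclidean_space set \<Rightarrow> real \<Rightarrow> 'a \<Rightarrow> real" where
  "level K a v = Sup {s. a \<le> measure lebesgue (cap K v s)}"

lemma compact_cap: "compact K \<Longrightarrow> compact (cap K v s)"
  unfolding cap_def by (intro compact_Int_closed closed_halfspace_ge)

lemma lmeasurable_cap [simp]: "compact K \<Longrightarrow> cap K v s \<in> lmeasurable"
  by (intro lmeasurable_compact compact_cap)

lemma lmeasurable_cap_open:
  assumes "compact K"
  shows "K \<inter> {x. s < v \<bullet> x} \<in> lmeasurable"
proof (rule fmeasurable_Int_fmeasurable)
  show "{x. s < v \<bullet> x} \<in> sets lebesgue"
    by (intro sets_completionI_sets) (simp add: borel_open open_halfspace_gt)
qed (rule lmeasurable_compact[OF assms])

lemma measure_cap_open: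
  assumes K: "compact K" and v: "v \<noteq> 0"
  shows "measure lebesgue (K \<inter> {x. s < v \<bullet> x}) = measure lebesgue (cap K v s)"
proof (rule measure_negligible_symdiff)
  show "negligible (cap K v s - (K \<inter> {x. s < v \<bullet> x}) \<union> (K \<inter> {x. s < v \<bullet> x} - cap K v s))"
    by (rule negligible_subset[OF negligible_hyperplane[of v s]]) (use v in \<open>auto simp: cap_def\<close>)
qed (use K in simp)

lemma measure_cap_antimono:
  assumes "compact K" "s \<le> t"
  shows "measure lebesgue (cap K v t) \<le> measure lebesgue (cap K v s)"
proof (rule measure_mono_fmeasurable)
  show "cap K v t \<subseteq> cap K v s" using assms by (auto simp: cap_def)
qed (use assms in \<open>simp_all add: fmeasurableD\<close>)

text \<open>The area is continuous in the height: closed caps are limits of larger caps from below,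
  and open caps are limits of smaller caps from above. Both limits have the same area because a
  hyperplane is a null set.\<close>

lemma
  fixes K :: "'a::euclidean_space set"
  assumes K: "compact K" and v: "v \<noteq> 0" and a: "0 < a" "a < measure lebesgue K"
  shows le_level: "a \<le> measure lebesgue (cap K v s) \<Longrightarrow> s \<le> level K a v"
    and measure_cap_level: "measure lebesgue (cap K v (level K a v)) = a"
proof -
  let ?S = "{s. a \<le> measure lebesgue (cap K v s)}"
  let ?l = "level K a v"
  obtain R where R: "\<And>x. x \<in> K \<Longrightarrow> norm x \<le> R"
    using compact_imp_bounded[OF K] unfolding bounded_iff by blast
  have bound: "\<bar>v \<bullet> x\<bar> \<le> norm v * R" if "x \<in> K" for x
    using Cauchy_Schwarz_ineq2[of v x] mult_left_mono[OF R[OF that], of "norm v"] by simp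
  have "- (norm v * R) \<le> v \<bullet> x" if "x \<in> K" for x
    using bound[OF that] by linarith
  \<comment> \<open>Below every value of \<open>v \<bullet> x\<close> on \<open>K\<close> the cap is
    all of \<open>K\<close>, so the supremum runs over a nonempty set.\<close>
  then have "cap K v (- (norm v * R)) = K"
    unfolding cap_def by blast
  with a have ne: "- (norm v * R) \<in> ?S" by simp
  have "s \<le> norm v * R" if "s \<in> ?S" for s
  proof (rule ccontr)
    assume "\<not> ?thesis"
    then have "v \<bullet> x < s" if "x \<in> K" for x using bound[OF that] by linarith
    then have "cap K v s = {}" unfolding cap_def using not_le by blast
    with that a show False by simp
  qed
  then have bdd: "bdd_above ?S" unfolding bdd_above_def by blast
  show le: "s \<le> ?l" if "a \<le> measure lebesgue (cap K v s)" for s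
    unfolding level_def using cSup_upper[OF _ bdd] that by simp
  have "a \<le> measure lebesgue (cap K v ?l)"
  proof -
    \<comment> \<open>Caps at heights increasing to the level all have area at least
      \<open>a\<close> and shrink to the closed cap.\<close>
    define A where "A n = cap K v (?l - 1 / real (Suc n))" for n
    have "a \<le> measure lebesgue (A n)" for n
    proof -
      have "?l - 1 / real (Suc n) < Sup ?S" by (simp add: level_def)
      then obtain s where "s \<in> ?S" "?l - 1 / real (Suc n) < s"
        using less_cSup_iff[of ?S] ne bdd by blast
      with measure_cap_antimono[OF K, of "?l - 1 / real (Suc n)" s v] show ?thesis
        unfolding A_def by simp
    qed
    moreover have "(\<lambda>n. measure lebesgue (A n)) \<longlonglongrightarrow> measure lebesgue (\<Inter>n. A n)"
    proof (rule Lim_measure_decseq)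
      have *: "?l - 1 / real (Suc m) \<le> ?l - 1 / real (Suc n)" if "m \<le> n" for m n
        using that by (simp add: frac_le)
      show "decseq A"
        unfolding decseq_def A_def cap_def using order_trans[OF *] by blast
      show "range A \<subseteq> sets lebesgue" using fmeasurableD[OF lmeasurable_cap[OF K]] unfolding A_def by blast
      show "emeasure lebesgue (A n) \<noteq> \<infinity>" for n
        using fmeasurableD2[OF lmeasurable_cap[OF K]] unfolding A_def by simp
    qed
    moreover have "(\<Inter>n. A n) = cap K v ?l"
    proof -
      have "?l \<le> v \<bullet> x" if "\<forall>n. ?l - 1 / real (Suc n) \<le> v \<bullet> x" for x
      proof (rule ccontr)
        assume "\<not> ?thesis"
        then obtain n where "inverse (real (Suc n)) < ?l - v \<bullet> x"
          using reals_Archimedean[of "?l - v \<bullet> x"] by (auto simp del: of_nat_Suc)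
        with that[rule_format, of n] show False by (simp add: inverse_eq_divide)
      qed
      moreover have "?l - 1 / real (Suc n) \<le> v \<bullet> x" if "?l \<le> v \<bullet> x" for x n
      proof -
        have "0 \<le> 1 / real (Suc n)" by simp
        with that show ?thesis by linarith
      qed
      ultimately show ?thesis unfolding A_def cap_def by blast
    qed
    ultimately show ?thesis using LIMSEQ_le_const by metis
  qed
  moreover have "measure lebesgue (cap K v ?l) \<le> a"
  proof -
    \<comment> \<open>Caps above the level have area at most \<open>a\<close>, as the level is an
      upper bound. They grow to the open cap only, hence the passage through
      \<open>measure_cap_open\<close>.\<close>
    define A where "A n = cap K v (?l + 1 / real (Suc n))" for n
    have "measure lebesgue (A n) \<le> a" for n
    proof (rule ccontr)
      assume "\<not> ?thesis"
      then have "?l + 1 / real (Suc n) \<le> ?l" unfolding A_def by (intro le) simp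
      moreover have "0 < 1 / real (Suc n)" by simp
      ultimately show False by linarith
    qed
    moreover have "(\<lambda>n. measure lebesgue (A n)) \<longlonglongrightarrow> measure lebesgue (\<Union>n. A n)"
    proof (rule Lim_measure_incseq)
      have *: "?l + 1 / real (Suc n) \<le> ?l + 1 / real (Suc m)" if "m \<le> n" for m n
        using that by (simp add: frac_le)
      show "incseq A"
        unfolding incseq_def A_def cap_def using order_trans[OF *] by blast
      have "(\<Union>n. A n) \<subseteq> K" by (auto simp: A_def cap_def)
      then show "emeasure lebesgue (\<Union>n. A n) \<noteq> \<infinity>"
        using emeasure_mono[of "\<Union>n. A n" K lebesgue] fmeasurableD[OF lmeasurable_compact[OF K]]
          fmeasurableD2[OF lmeasurable_compact[OF K]] by (simp add: neq_top_trans)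
      show "range A \<subseteq> sets lebesgue" using fmeasurableD[OF lmeasurable_cap[OF K]] unfolding A_def by blast
    qed
    moreover have "(\<Union>n. A n) = K \<inter> {x. ?l < v \<bullet> x}"
    proof -
      have "\<exists>n. ?l + 1 / real (Suc n) \<le> v \<bullet> x" if less: "?l < v \<bullet> x" for x
      proof -
        obtain n where "inverse (real (Suc n)) < v \<bullet> x - ?l"
          using reals_Archimedean[of "v \<bullet> x - ?l"] less by (auto simp del: of_nat_Suc)
        then have "?l + 1 / real (Suc n) \<le> v \<bullet> x" by (simp only: inverse_eq_divide)
        then show ?thesis by blast
      qed
      moreover have "?l < v \<bullet> x" if "?l + 1 / real (Suc n) \<le> v \<bullet> x" for x n
      proof -
        have "0 < 1 / real (Suc n)" by simp
        with that show ?thesis by linarith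
      qed
      ultimately show ?thesis unfolding A_def cap_def by blast
    qed
    ultimately show ?thesis
      using measure_cap_open[OF K v, of ?l] LIMSEQ_le_const2 by metis
  qed
  ultimately show "measure lebesgue (cap K v ?l) = a" by simp
qed

section \<open>Planar frames\<close>

lemma
  fixes S :: "(real^2) set"
  assumes "S \<in> lmeasurable"
  shows lmeasurable_point_reflection: "(\<lambda>x. c - x) ` S \<in> lmeasurable"
    and measure_point_reflection: "measure lebesgue ((\<lambda>x. c - x) ` S) = measure lebesgue S"
proof -
  have "(\<lambda>x. c - x) ` S = (+) c ` uminus ` S" by (auto simp: image_image)
  moreover have "uminus ` S \<in> lmeasurable"
    by (rule measurable_linear_image) (use assms in \<open>auto simp: linear_uminus module_hom_uminus\<close>)
  ultimately show "(\<lambda>x. c - x) ` S \<in> lmeasurable" by (simp add: measurable_translation)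
  show "measure lebesgue ((\<lambda>x. c - x) ` S) = measure lebesgue S"
    using measure_lebesgue_affine[of "-1" c S] by (simp add: add.commute)
qed

text \<open>\<open>v\<close> is the normal of the strip and serves as the vertical direction,
  \<open>w\<close> is the direction of its chords; points are written
  \<open>X *\<^sub>R w + Y *\<^sub>R v\<close>.\<close>

definition frame :: "real^2 \<Rightarrow> real^2 \<Rightarrow> bool" where
  "frame v w \<longleftrightarrow> v \<bullet> v = 1 \<and> w \<bullet> w = 1 \<and> v \<bullet> w = 0"

lemma frame_uminus: "frame v w \<Longrightarrow> frame (- v) w" "frame v w \<Longrightarrow> frame v (- w)"
  by (simp_all add: frame_def)

lemma frame_exists:
  assumes "norm v = 1"
  obtains w where "frame v w"
proof
  show "frame v (vector [- v$2, v$1])"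
    using assms by (auto simp: frame_def inner_vec_def sum_2 norm_eq_1 vector_2)
qed

lemma frame_inner [simp]:
  assumes "frame v w"
  shows "v \<bullet> (X *\<^sub>R w + Y *\<^sub>R v) = Y" "w \<bullet> (X *\<^sub>R w + Y *\<^sub>R v) = X"
  using assms by (simp_all add: frame_def inner_add_right inner_commute)

lemma frame_expand:
  assumes "frame v w"
  shows "(w \<bullet> x) *\<^sub>R w + (v \<bullet> x) *\<^sub>R v = x"
proof -
  define z where "z = x - ((w \<bullet> x) *\<^sub>R w + (v \<bullet> x) *\<^sub>R v)"
  let ?d = "v$1 * w$2 - v$2 * w$1"
  have z: "v$1 * z$1 + v$2 * z$2 = 0" "w$1 * z$1 + w$2 * z$2 = 0"
    using frame_inner[OF assms, of "w \<bullet> x" "v \<bullet> x"]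
    unfolding z_def inner_vec_def sum_2 by (simp_all add: inner_vec_def sum_2 algebra_simps)
  have f: "v$1 * v$1 + v$2 * v$2 = 1" "w$1 * w$1 + w$2 * w$2 = 1" "v$1 * w$1 + v$2 * w$2 = 0"
    using assms by (simp_all add: frame_def inner_vec_def sum_2)
  \<comment> \<open>Lagrange's identity: the squared determinant is the Gram determinant, here 1. So
    the remainder \<open>z\<close>, orthogonal to both \<open>v\<close> and \<open>w\<close>,
    vanishes.\<close>
  have "?d^2 = (v$1 * v$1 + v$2 * v$2) * (w$1 * w$1 + w$2 * w$2) - (v$1 * w$1 + v$2 * w$2)^2"
    by algebra
  with f have "?d \<noteq> 0" by auto
  moreover have "z$1 * ?d = 0" using z by algebra
  moreover have "z$2 * ?d = 0" using z by algebra
  ultimately have "z = 0" by (simp add: vec_eq_iff forall_2)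
  then show ?thesis by (simp add: z_def)
qed

text \<open>Such a point lies on the segment from the interior point \<open>z\<close> to one of the
  two ends and differs from that end, so it is interior by convexity.\<close>

lemma chord_interior:
  assumes f: "frame v w" and K: "convex K" and z: "z \<in> interior K" "v \<bullet> z = s"
    and pq: "p *\<^sub>R w + s *\<^sub>R v \<in> K" "q *\<^sub>R w + s *\<^sub>R v \<in> K" and X: "p < X" "X < q"
  shows "X *\<^sub>R w + s *\<^sub>R v \<in> interior K"
proof -
  define Z where "Z = w \<bullet> z"
  have zeq: "z = Z *\<^sub>R w + s *\<^sub>R v" using frame_expand[OF f, of z] z by (simp add: Z_def)
  have main: "X *\<^sub>R w + s *\<^sub>R v \<in> interior K"
    if "u *\<^sub>R w + s *\<^sub>R v \<in> K" "0 < e" "e \<le> 1" "X = u - e * (u - Z)" for u e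
  proof -
    have "u *\<^sub>R w + s *\<^sub>R v - e *\<^sub>R (u *\<^sub>R w + s *\<^sub>R v - z) \<in> interior K"
      by (rule mem_interior_convex_shrink[OF K z(1)]) (use that in auto)
    moreover have "u *\<^sub>R w + s *\<^sub>R v - e *\<^sub>R (u *\<^sub>R w + s *\<^sub>R v - z) = X *\<^sub>R w + s *\<^sub>R v"
      by (simp add: zeq that(4) algebra_simps)
    ultimately show ?thesis by simp
  qed
  show ?thesis
  proof (cases "X \<le> Z")
    case True
    with X show ?thesis
      by (intro main[OF pq(1), of "(X - p) / (Z - p)"]) (auto simp: field_simps)
  next
    case False
    with X show ?thesis
      by (intro main[OF pq(2), of "(q - X) / (q - Z)"]) (auto simp: field_simps)
  qed
qed

lemma interior_vertical:
  assumes f: "frame v w" and "X *\<^sub>R w + s *\<^sub>R v \<in> interior K"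
  obtains e where "e > 0" "\<And>y. \<bar>y\<bar> \<le> e \<Longrightarrow> X *\<^sub>R w + (s + y) *\<^sub>R v \<in> K"
proof -
  obtain e where e: "e > 0" "cball (X *\<^sub>R w + s *\<^sub>R v) e \<subseteq> K"
    using assms(2) mem_interior_cball by blast
  have "norm v = 1" using f by (simp add: frame_def norm_eq_1)
  then have "X *\<^sub>R w + (s + y) *\<^sub>R v \<in> cball (X *\<^sub>R w + s *\<^sub>R v) e" if "\<bar>y\<bar> \<le> e" for y
    using that by (simp add: dist_norm algebra_simps)
  with e that show ?thesis by blast
qed

lemma convex_horizontal:
  assumes "convex K" "X1 *\<^sub>R w + Y *\<^sub>R v \<in> K" "X2 *\<^sub>R w + Y *\<^sub>R v \<in> K" "X1 \<le> X" "X \<le> X2"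
  shows "X *\<^sub>R w + Y *\<^sub>R v \<in> K"
proof (cases "X1 = X2")
  case True
  then show ?thesis using assms by simp
next
  case False
  let ?t = "(X - X1) / (X2 - X1)"
  have "?t * (X2 - X1) = X - X1" using False by simp
  then have "(1 - ?t) * X1 + ?t * X2 = X" by (simp only: algebra_simps)
  moreover have "0 \<le> ?t" "?t \<le> 1" using assms False by (auto simp: field_simps)
  ultimately have t: "0 \<le> ?t" "?t \<le> 1" "(1 - ?t) * X1 + ?t * X2 = X" by auto
  have "(1 - ?t) *\<^sub>R (X1 *\<^sub>R w + Y *\<^sub>R v) + ?t *\<^sub>R (X2 *\<^sub>R w + Y *\<^sub>R v) \<in> K"
    using assms t by (intro convexD_alt) auto
  also have "(1 - ?t) *\<^sub>R (X1 *\<^sub>R w + Y *\<^sub>R v) + ?t *\<^sub>R (X2 *\<^sub>R w + Y *\<^sub>R v)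
      = ((1 - ?t) * X1 + ?t * X2) *\<^sub>R w + Y *\<^sub>R v"
    by (simp only: scaleR_add_right scaleR_add_left scaleR_scaleR scaleR_diff_left left_diff_distrib) simp
  finally show ?thesis using t by simp
qed

section \<open>Tilting a chord\<close>

text \<open>Turning the line \<open>v \<bullet> x = s\<close> about a point beyond the midpoint of its chord does not
  decrease the area of the cap: the point reflection about the pivot carries the lost wedge into
  the gained one.\<close>

lemma measure_cap_tilt:
  assumes f: "frame v w" and K: "compact K" "convex K" and z: "z \<in> interior K" "v \<bullet> z = s"
    and p: "p *\<^sub>R w + s *\<^sub>R v \<in> K" and q: "q *\<^sub>R w + s *\<^sub>R v \<in> K"
    and qmax: "\<And>x. x \<in> K \<Longrightarrow> v \<bullet> x = s \<Longrightarrow> w \<bullet> x \<le> q"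
    and m: "(p + q) / 2 < m" "m < q"
  obtains e0 where "e0 > 0"
    "\<And>e. 0 < e \<Longrightarrow> e < e0 \<Longrightarrow>
       measure lebesgue (cap K v s) \<le> measure lebesgue (cap K (v - e *\<^sub>R w) (s - e * m))"
proof -
  \<comment> \<open>Reflection about \<open>m\<close> takes \<open>q\<close> to
    \<open>2 * m - q\<close>, which exceeds \<open>p\<close> since \<open>m\<close> lies beyond the
    midpoint. Halfway between these two, \<open>p'\<close> leaves room on both sides.\<close>
  define p' where "p' = (p + (2 * m - q)) / 2"
  have p': "p < p'" "p' < 2 * m - q" "p' < m" using m by (auto simp: p'_def field_simps)
  have int: "m *\<^sub>R w + s *\<^sub>R v \<in> interior K" "p' *\<^sub>R w + s *\<^sub>R v \<in> interior K"
    by (rule chord_interior[OF f K(2) z p q]; use m p' in linarith)+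
  obtain e1 where e1: "e1 > 0" "\<And>y. \<bar>y\<bar> \<le> e1 \<Longrightarrow> m *\<^sub>R w + (s + y) *\<^sub>R v \<in> K"
    by (rule interior_vertical[OF f int(1)]) (rule that)
  obtain e2 where e2: "e2 > 0" "\<And>y. \<bar>y\<bar> \<le> e2 \<Longrightarrow> p' *\<^sub>R w + (s + y) *\<^sub>R v \<in> K"
    by (rule interior_vertical[OF f int(2)]) (rule that)
  define h where "h = min e1 e2"
  have h: "h > 0" "\<And>y. \<bar>y\<bar> \<le> h \<Longrightarrow> m *\<^sub>R w + (s + y) *\<^sub>R v \<in> K"
    "\<And>y. \<bar>y\<bar> \<le> h \<Longrightarrow> p' *\<^sub>R w + (s + y) *\<^sub>R v \<in> K"
    using e1 e2 by (auto simp: h_def)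
  \<comment> \<open>The segment from \<open>x\<close> to the point at depth \<open>h\<close> below
    the pivot crosses the line \<open>v \<bullet> x = s\<close> inside the chord. This bounds how
    far \<open>x\<close> can overhang the end \<open>q\<close>.\<close>
  have spread: "h * (w \<bullet> x) \<le> h * q + y * (q - m)" if x: "x \<in> K" and y: "v \<bullet> x = s + y" "0 \<le> y" for x y
  proof -
    define a b where "a = h / (h + y)" and "b = y / (h + y)"
    have ab: "0 \<le> a" "0 \<le> b" "a + b = 1" "a * y = b * h" "a * (h + y) = h" "b * (h + y) = y"
      using h(1) y(2) by (simp_all add: a_def b_def add_divide_distrib[symmetric])
    define c where "c = a *\<^sub>R x + b *\<^sub>R (m *\<^sub>R w + (s + - h) *\<^sub>R v)"
    have "m *\<^sub>R w + (s + - h) *\<^sub>R v \<in> K" by (rule h(2)) (use h(1) in simp)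
    then have "c \<in> K" unfolding c_def by (rule convexD[OF K(2) x]) (use ab in simp_all)
    moreover have "v \<bullet> c = s"
    proof -
      have "v \<bullet> c = a * (s + y) + b * (s + - h)"
        unfolding c_def inner_add_right[of v "a *\<^sub>R x"] inner_scaleR_right[of v a] inner_scaleR_right[of v b]
        using frame_inner(1)[OF f, of m "s + - h"] y(1) by simp
      also have "\<dots> = (a + b) * s + (a * y - b * h)" by algebra
      finally show ?thesis using ab by simp
    qed
    ultimately have "w \<bullet> c \<le> q" by (rule qmax)
    moreover have "w \<bullet> c = a * (w \<bullet> x) + b * m"
      unfolding c_def inner_add_right[of w "a *\<^sub>R x"] inner_scaleR_right[of w a] inner_scaleR_right[of w b]
      using frame_inner(2)[OF f, of m "s + - h"] by simp
    ultimately have "(a * (w \<bullet> x) + b * m) * (h + y) \<le> q * (h + y)" using h(1) y(2) by simp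
    moreover have "(a * (w \<bullet> x) + b * m) * (h + y) = a * (h + y) * (w \<bullet> x) + b * (h + y) * m" by algebra
    ultimately show ?thesis unfolding ab by (simp add: algebra_simps)
  qed
  obtain R where R: "\<And>x. x \<in> K \<Longrightarrow> norm x \<le> R"
    using compact_imp_bounded[OF K(1)] unfolding bounded_iff by blast
  \<comment> \<open>\<open>D\<close> bounds the horizontal distance from the pivot, so a wedge of
    slope below \<open>k / D\<close> stays below height \<open>k\<close>.\<close>
  define D where "D = \<bar>R\<bar> + \<bar>m\<bar> + 1"
  have D: "w \<bullet> x - m < D" if "x \<in> K" for x
  proof -
    have "norm w = 1" using f by (simp add: frame_def norm_eq_1)
    then have "w \<bullet> x \<le> R" using norm_cauchy_schwarz[of w x] R[OF that] by simp
    then show ?thesis unfolding D_def by linarith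
  qed
  have "D > 0" by (simp add: D_def)
  \<comment> \<open>Below height \<open>k\<close> the overhang is so small that the reflected point
    stays to the right of \<open>p'\<close>.\<close>
  define k where "k = min h (h * (2 * m - p' - q) / (q - m))"
  have k: "k > 0" "k \<le> h" "k * (q - m) \<le> h * (2 * m - p' - q)"
  proof -
    have "0 < h * (2 * m - p' - q) / (q - m)" using h m p' by simp
    then show "k > 0" using h by (simp add: k_def)
    have "k \<le> h * (2 * m - p' - q) / (q - m)" by (simp add: k_def)
    then show "k * (q - m) \<le> h * (2 * m - p' - q)" using m by (simp add: pos_le_divide_eq)
  qed (simp add: k_def)
  show ?thesis
  proof
    show "k / D > 0" using k \<open>D > 0\<close> by simp
    fix e :: real assume e: "0 < e" "e < k / D"
    let ?u = "v - e *\<^sub>R w"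
    \<comment> \<open>\<open>A\<close> is the old cap without its boundary line, \<open>L\<close>
      the wedge lost by tilting, and \<open>c - x\<close> the point reflection about the
      pivot.\<close>
    define A where "A = K \<inter> {x. s < v \<bullet> x}"
    define L where "L = A \<inter> {x. ?u \<bullet> x < s - e * m}"
    define c where "c = 2 *\<^sub>R (m *\<^sub>R w + s *\<^sub>R v)"
    have vc: "v \<bullet> c = 2 * s" "w \<bullet> c = 2 * m"
      unfolding c_def inner_scaleR_right using frame_inner[OF f] by simp_all
    have A: "A \<in> lmeasurable" unfolding A_def by (rule lmeasurable_cap_open[OF K(1)])
    have "{x. ?u \<bullet> x < s - e * m} \<in> sets lebesgue"
      by (intro sets_completionI_sets) (simp add: borel_open open_halfspace_lt)
    then have L: "L \<in> lmeasurable" unfolding L_def by (rule fmeasurable_Int_fmeasurable[OF A])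
    have refl: "c - x \<in> cap K ?u (s - e * m) \<and> v \<bullet> (c - x) < s" if x: "x \<in> L" for x
    proof -
      define X where "X = w \<bullet> x"
      define y where "y = v \<bullet> x - s"
      have xK: "x \<in> K" and y0: "0 < y" and lt: "y < e * (X - m)"
        using x by (auto simp: L_def A_def X_def y_def inner_diff_left algebra_simps)
      have "e * (X - m) \<le> e * D" using D[OF xK] e by (intro mult_left_mono) (auto simp: X_def)
      also have "e * D < k" using e \<open>D > 0\<close> by (simp add: pos_less_divide_eq)
      finally have yk: "y < k" using lt by simp
      have "0 < e * (X - m)" using lt y0 by linarith
      then have Xm: "m < X" using e by (simp add: zero_less_mult_iff)
      have "h * X \<le> h * q + y * (q - m)"
        using spread[OF xK, of y] y0 by (simp add: X_def y_def)
      also have "y * (q - m) \<le> k * (q - m)" using yk m by (intro mult_right_mono) auto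
      also have "k * (q - m) \<le> h * (2 * m - p' - q)" by (rule k)
      finally have "h * X \<le> h * (2 * m - p')" by (simp add: algebra_simps)
      then have X': "X \<le> 2 * m - p'" using h by simp
      \<comment> \<open>The reflected point lies between the vertical segments in \<open>K\<close>
        through \<open>p'\<close> and \<open>m\<close>.\<close>
      have in1: "(2 * m - X) *\<^sub>R w + (s + - y) *\<^sub>R v \<in> K"
        by (rule convex_horizontal[OF K(2) h(3) h(2)]) (use X' Xm yk y0 k in auto)
      have "c - x = (2 * m - X) *\<^sub>R w + (s + - y) *\<^sub>R v"
        using frame_expand[OF f, of "c - x"] vc by (simp add: inner_diff_right X_def y_def)
      with in1 have "c - x \<in> K" by simp
      moreover have vcx: "v \<bullet> (c - x) = s - y" "w \<bullet> (c - x) = 2 * m - X"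
        by (simp_all add: inner_diff_right vc X_def y_def)
      moreover have "?u \<bullet> (c - x) = (s - y) - e * (2 * m - X)"
        by (simp only: inner_diff_left inner_scaleR_left vcx)
      moreover have "s - e * m \<le> (s - y) - e * (2 * m - X)"
        using lt by (simp add: algebra_simps)
      ultimately show ?thesis unfolding cap_def using y0 by simp
    qed
    have disj: "(\<lambda>x. c - x) ` L - (A - L) = (\<lambda>x. c - x) ` L"
    proof -
      have "c - x \<notin> A" if "x \<in> L" for x using refl[OF that] by (simp add: A_def)
      then show ?thesis by blast
    qed
    have AL: "A - L \<in> lmeasurable" by (rule fmeasurable.Diff[OF A L])
    have "measure lebesgue (cap K v s) = measure lebesgue A"
      unfolding A_def using f by (subst measure_cap_open[OF K(1)]) (auto simp: frame_def)
    also have "A = L \<union> A" by (auto simp: L_def)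
    also have "measure lebesgue \<dots> = measure lebesgue L + measure lebesgue (A - L)"
      by (rule measure_Un2[OF L A])
    also have "measure lebesgue L = measure lebesgue ((\<lambda>x. c - x) ` L - (A - L))"
      by (simp only: disj measure_point_reflection[OF L])
    also have "\<dots> + measure lebesgue (A - L) = measure lebesgue ((A - L) \<union> (\<lambda>x. c - x) ` L)"
      by (subst measure_Un2[OF AL lmeasurable_point_reflection[OF L]]) simp
    also have "\<dots> \<le> measure lebesgue (cap K ?u (s - e * m))"
    proof (rule measure_mono_fmeasurable)
      show "(A - L) \<union> (\<lambda>x. c - x) ` L \<subseteq> cap K ?u (s - e * m)"
        using refl unfolding A_def L_def by (auto simp: cap_def)
      show "(A - L) \<union> (\<lambda>x. c - x) ` L \<in> sets lebesgue"
        by (rule fmeasurableD[OF fmeasurable.Un[OF AL lmeasurable_point_reflection[OF L]]])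
    qed (use K in simp)
    finally show "measure lebesgue (cap K v s) \<le> measure lebesgue (cap K ?u (s - e * m))" .
  qed
qed

section \<open>The widest strip between caps of equal area\<close>

text \<open>On \<open>K\<close> the two functionals differ by at most
  \<open>R * norm (u - v)\<close>, so the cap in direction \<open>u\<close> is contained in the cap
  in direction \<open>v\<close> at a height lowered by that amount.\<close>

lemma level_lipschitz:
  fixes K :: "'a::euclidean_space set"
  assumes K: "compact K" and a: "0 < a" "a < measure lebesgue K"
    and R: "\<And>x. x \<in> K \<Longrightarrow> norm x \<le> R" and uv: "u \<noteq> 0" "v \<noteq> 0"
  shows "level K a u - R * norm (u - v) \<le> level K a v"
proof (rule le_level[OF K uv(2) a])
  have "cap K u (level K a u) \<subseteq> cap K v (level K a u - R * norm (u - v))"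
  proof
    fix x assume x: "x \<in> cap K u (level K a u)"
    have "(u - v) \<bullet> x \<le> norm (u - v) * norm x" by (rule norm_cauchy_schwarz)
    also have "\<dots> \<le> norm (u - v) * R" using x R by (intro mult_left_mono) (auto simp: cap_def)
    finally show "x \<in> cap K v (level K a u - R * norm (u - v))"
      using x by (simp add: cap_def inner_diff_left algebra_simps)
  qed
  then have "measure lebesgue (cap K u (level K a u)) \<le> measure lebesgue (cap K v (level K a u - R * norm (u - v)))"
    using K by (intro measure_mono_fmeasurable) (simp_all add: fmeasurableD)
  then show "a \<le> measure lebesgue (cap K v (level K a u - R * norm (u - v)))"
    by (simp add: measure_cap_level[OF K uv(1) a])
qed

lemma cap_scaleR: "0 < c \<Longrightarrow> cap K (c *\<^sub>R v) (c * s) = cap K v s"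
  by (simp add: cap_def)

text \<open>The width is Lipschitz on the unit sphere and so attains its maximum. The factor
  \<open>norm u\<close> extends the inequality to normals that are not unit vectors, such as the
  tilted normals \<open>v - e *\<^sub>R w\<close>.\<close>

lemma widest_strip:
  fixes K :: "'a::euclidean_space set"
  assumes K: "compact K" and a: "0 < a" "a < measure lebesgue K"
  obtains v where "norm v = 1"
    "\<And>u r t. u \<noteq> 0 \<Longrightarrow> a \<le> measure lebesgue (cap K u r) \<Longrightarrow> a \<le> measure lebesgue (cap K (- u) t) \<Longrightarrow>
       r + t \<le> (level K a v + level K a (- v)) * norm u"
proof -
  let ?g = "\<lambda>v. level K a v + level K a (- v)"
  obtain R where R: "\<And>x. x \<in> K \<Longrightarrow> norm x \<le> R"
    using compact_imp_bounded[OF K] unfolding bounded_iff by blast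
  have "K \<noteq> {}" using a by auto
  then obtain x0 where "x0 \<in> K" by blast
  with R[OF this] have R0: "0 \<le> R" by (meson norm_ge_zero order_trans)
  have "(2 * R)-lipschitz_on (sphere 0 1) ?g"
  proof (rule lipschitz_onI)
    fix u v :: 'a assume uv: "u \<in> sphere 0 1" "v \<in> sphere 0 1"
    then have [simp]: "u \<noteq> 0" "v \<noteq> 0" by auto
    have n: "norm (v - u) = norm (u - v)" "norm (- u + v) = norm (u - v)" "norm (- v + u) = norm (u - v)"
      by (simp_all add: norm_minus_commute)
    show "dist (?g u) (?g v) \<le> 2 * R * dist u v"
      using level_lipschitz[OF K a R, of u v] level_lipschitz[OF K a R, of v u]
        level_lipschitz[OF K a R, of "- u" "- v"] level_lipschitz[OF K a R, of "- v" "- u"]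
      by (simp add: dist_norm n abs_le_iff)
  qed (use R0 in simp)
  then have "continuous_on (sphere 0 1) ?g" by (rule lipschitz_on_continuous_on)
  then obtain v where v: "v \<in> sphere (0::'a) 1" and max: "\<And>u. u \<in> sphere 0 1 \<Longrightarrow> ?g u \<le> ?g v"
    using continuous_attains_sup[of "sphere (0::'a) 1" ?g] by auto
  show ?thesis
  proof
    show "norm v = 1" using v by simp
    fix u :: 'a and r t assume u: "u \<noteq> 0" and le: "a \<le> measure lebesgue (cap K u r)"
      "a \<le> measure lebesgue (cap K (- u) t)"
    let ?c = "inverse (norm u)"
    have c: "?c > 0" using u by simp
    have "?c * r \<le> level K a (?c *\<^sub>R u)"
      by (rule le_level[OF K _ a]) (use u le(1) cap_scaleR[OF c, of K u r] in simp_all)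
    moreover have "?c * t \<le> level K a (- (?c *\<^sub>R u))"
      by (rule le_level[OF K _ a]) (use u le(2) cap_scaleR[OF c, of K "- u" t] in simp_all)
    moreover have "?g (?c *\<^sub>R u) \<le> ?g v" using u by (intro max) simp
    ultimately have "?c * (r + t) \<le> ?g v" by (simp add: distrib_left)
    then show "r + t \<le> ?g v * norm u" using u by (simp add: field_simps)
  qed
qed

text \<open>Both sides of the line carry positive area and therefore interior points of
  \<open>K\<close>. The interior is connected, so it meets the line, and a small ball about a common
  point makes the chord nondegenerate.\<close>

lemma chord_ends:
  assumes f: "frame v w" and K: "compact K" "convex K"
    and pos: "0 < measure lebesgue (cap K v s)" "measure lebesgue (cap K v s) < measure lebesgue K"
  obtains z p q where "z \<in> interior K" "v \<bullet> z = s" "p < q"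
    "p *\<^sub>R w + s *\<^sub>R v \<in> K" "q *\<^sub>R w + s *\<^sub>R v \<in> K"
    "\<And>x. x \<in> K \<Longrightarrow> v \<bullet> x = s \<Longrightarrow> p \<le> w \<bullet> x \<and> w \<bullet> x \<le> q"
proof -
  have cvx: "convex (cap K u r)" for u r
    unfolding cap_def by (intro convex_Int K convex_halfspace_ge)
  have ne: "interior (cap K u r) \<noteq> {}" if "0 < measure lebesgue (cap K u r)" for u r
    using that negligible_convex_interior[OF cvx, of u r] negligible_imp_measure0[of "cap K u r"] by auto
  have sub: "interior (cap K u r) \<subseteq> interior K \<inter> {x. r \<le> u \<bullet> x}" for u r
    using interior_mono[of "cap K u r" K] interior_subset[of "cap K u r"] by (auto simp: cap_def)
  have "measure lebesgue K \<le> measure lebesgue (cap K v s \<union> cap K (- v) (- s))"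
    using K by (intro measure_mono_fmeasurable)
      (auto simp: cap_def[abs_def] intro!: fmeasurableD lmeasurable_compact compact_Un compact_Int_closed
        closed_halfspace_ge closed_halfspace_le)
  also have "\<dots> \<le> measure lebesgue (cap K v s) + measure lebesgue (cap K (- v) (- s))"
    using K by (intro measure_Un_le) (simp_all add: fmeasurableD)
  finally have pos': "0 < measure lebesgue (cap K (- v) (- s))" using pos by linarith
  obtain x1 where x1: "x1 \<in> interior K" "s \<le> v \<bullet> x1" using ne[OF pos(1)] sub by blast
  obtain x2 where x2: "x2 \<in> interior K" "v \<bullet> x2 \<le> s" using ne[OF pos'] sub[of "- v" "- s"] by auto
  obtain z where z: "z \<in> interior K" "v \<bullet> z = s"
  proof -
    have "connected ((\<lambda>x. v \<bullet> x) ` interior K)"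
      by (intro connected_continuous_image convex_connected convex_interior K continuous_intros)
    then have "s \<in> (\<lambda>x. v \<bullet> x) ` interior K"
      using connectedD_interval[of "(\<lambda>x. v \<bullet> x) ` interior K" "v \<bullet> x2" "v \<bullet> x1" s] x1 x2 by auto
    then show ?thesis using that by auto
  qed
  let ?C = "K \<inter> {x. v \<bullet> x = s}"
  have C: "compact ?C" using K by (intro compact_Int_closed closed_hyperplane)
  have zC: "z \<in> ?C" using z interior_subset by auto
  have cont: "continuous_on ?C (\<lambda>x. w \<bullet> x)" by (intro continuous_intros)
  obtain x where x: "x \<in> ?C" "\<And>y. y \<in> ?C \<Longrightarrow> w \<bullet> x \<le> w \<bullet> y"
    using continuous_attains_inf[OF C _ cont] zC by blast
  obtain y where y: "y \<in> ?C" "\<And>x. x \<in> ?C \<Longrightarrow> w \<bullet> x \<le> w \<bullet> y"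
    using continuous_attains_sup[OF C _ cont] zC by blast
  have "w \<bullet> x < w \<bullet> y"
  proof -
    obtain e where e: "e > 0" "cball z e \<subseteq> K" using z mem_interior_cball by blast
    have "norm w = 1" using f by (simp add: frame_def norm_eq_1)
    then have "z + e *\<^sub>R w \<in> ?C" using e z f
      by (auto simp: dist_norm inner_add_right frame_def intro!: subsetD[OF e(2)])
    then have "w \<bullet> (z + e *\<^sub>R w) \<le> w \<bullet> y" by (rule y)
    moreover have "w \<bullet> x \<le> w \<bullet> z" using x zC by blast
    ultimately show ?thesis using e(1) f by (simp add: inner_add_right frame_def)
  qed
  moreover have "(w \<bullet> x) *\<^sub>R w + s *\<^sub>R v \<in> K" "(w \<bullet> y) *\<^sub>R w + s *\<^sub>R v \<in> K"
    using frame_expand[OF f, of x] frame_expand[OF f, of y] x(1) y(1) by auto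
  ultimately show ?thesis using that[OF z, of "w \<bullet> x" "w \<bullet> y"] x(2) y(2) by blast
qed

lemma measure_le_opposite_caps:
  assumes K: "compact K" and "t \<le> s"
  shows "measure lebesgue K \<le> measure lebesgue (cap K v t) + measure lebesgue (cap K (- v) (- s))"
proof -
  have "K \<subseteq> cap K v t \<union> cap K (- v) (- s)" using assms(2) by (auto simp: cap_def)
  then have "measure lebesgue K \<le> measure lebesgue (cap K v t \<union> cap K (- v) (- s))"
    using K by (intro measure_mono_fmeasurable) (simp_all add: fmeasurableD fmeasurable.Un lmeasurable_compact)
  also have "\<dots> \<le> measure lebesgue (cap K v t) + measure lebesgue (cap K (- v) (- s))"
    using K by (intro measure_Un_le) (simp_all add: fmeasurableD)
  finally show ?thesis .
qed

text \<open>If the midpoints were in the opposite order, then turning both lines in the same sense about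
  points slightly off the midpoints would widen the strip to first order.\<close>

lemma widest_strip_midpoints:
  assumes f: "frame v w" and K: "compact K" "convex K" and "t \<le> s"
    and widest: "\<And>u r r'. u \<noteq> 0 \<Longrightarrow> measure lebesgue (cap K v s) \<le> measure lebesgue (cap K u r) \<Longrightarrow>
       measure lebesgue (cap K (- v) (- t)) \<le> measure lebesgue (cap K (- u) r') \<Longrightarrow> r + r' \<le> (s - t) * norm u"
    and z: "z \<in> interior K" "v \<bullet> z = s" and pq: "p < q"
    and p: "p *\<^sub>R w + s *\<^sub>R v \<in> K" and q: "q *\<^sub>R w + s *\<^sub>R v \<in> K"
    and qmax: "\<And>x. x \<in> K \<Longrightarrow> v \<bullet> x = s \<Longrightarrow> w \<bullet> x \<le> q"
    and z': "z' \<in> interior K" "v \<bullet> z' = t" and pq': "p' < q'"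
    and p': "p' *\<^sub>R w + t *\<^sub>R v \<in> K" and q': "q' *\<^sub>R w + t *\<^sub>R v \<in> K"
    and pmin: "\<And>x. x \<in> K \<Longrightarrow> v \<bullet> x = t \<Longrightarrow> p' \<le> w \<bullet> x"
  shows "p' + q' \<le> p + q"
proof (rule ccontr)
  assume "\<not> ?thesis"
  then have less: "(p + q) / 2 < (p' + q') / 2" by simp
  with pq have "(p + q) / 2 < min q ((p' + q') / 2)" by simp
  \<comment> \<open>The pivots \<open>m\<close> and \<open>m'\<close> are chosen between the two
    midpoints with \<open>m < m'\<close>; their distance is the first order gain in width.\<close>
  then obtain m where m: "(p + q) / 2 < m" "m < q" "m < (p' + q') / 2"
    using dense by (metis min_less_iff_conj)
  with pq' have "max m p' < (p' + q') / 2" by simp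
  then obtain m' where m': "m < m'" "p' < m'" "m' < (p' + q') / 2"
    using dense by (metis max_less_iff_conj)
  obtain e0 where e0: "e0 > 0" "\<And>e. 0 < e \<Longrightarrow> e < e0 \<Longrightarrow>
       measure lebesgue (cap K v s) \<le> measure lebesgue (cap K (v - e *\<^sub>R w) (s - e * m))"
  proof (rule measure_cap_tilt[OF f K z p q _ m(1,2)])
    show "w \<bullet> x \<le> q" if "x \<in> K" "v \<bullet> x = s" for x using that by (rule qmax)
  qed (rule that)
  \<comment> \<open>After a half turn the lower line becomes an upper one, and its pivot
    \<open>- m'\<close> lies beyond the midpoint of its chord as required.\<close>
  have f': "frame (- v) (- w)" using f by (simp add: frame_uminus)
  obtain e1 where e1: "e1 > 0" "\<And>e. 0 < e \<Longrightarrow> e < e1 \<Longrightarrow>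
       measure lebesgue (cap K (- v) (- t)) \<le> measure lebesgue (cap K (- v - e *\<^sub>R (- w)) (- t - e * (- m')))"
  proof (rule measure_cap_tilt[OF f' K z'(1), of "- t" "- q'" "- p'" "- m'"])
    show "- v \<bullet> z' = - t" using z' by simp
    show "- q' *\<^sub>R - w + - t *\<^sub>R - v \<in> K" "- p' *\<^sub>R - w + - t *\<^sub>R - v \<in> K" using p' q' by simp_all
    show "- w \<bullet> x \<le> - p'" if "x \<in> K" "- v \<bullet> x = - t" for x using pmin[of x] that by simp
    show "(- q' + - p') / 2 < - m'" "- m' < - p'" using m' by simp_all
  qed (rule that)
  \<comment> \<open>The gain \<open>e * (m' - m)\<close> is linear in \<open>e\<close>, the growth
    of \<open>norm ?u\<close> only quadratic. Adding 1 keeps the denominator positive when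
    \<open>s = t\<close>.\<close>
  have "0 < (m' - m) / (s - t + 1)" using m' \<open>t \<le> s\<close> by simp
  then have "0 < min (min e0 e1) ((m' - m) / (s - t + 1))" using e0(1) e1(1) by simp
  then obtain e where "0 < e" "e < min (min e0 e1) ((m' - m) / (s - t + 1))" using dense by blast
  then have e: "0 < e" "e < e0" "e < e1" "e < (m' - m) / (s - t + 1)" by simp_all
  let ?u = "v - e *\<^sub>R w"
  have u2: "?u \<bullet> ?u = 1 + e\<^sup>2"
    using f by (simp add: frame_def inner_diff_left inner_diff_right inner_commute power2_eq_square)
  then have u0: "?u \<noteq> 0" by (metis inner_zero_left add_pos_nonneg zero_less_one zero_le_power2 less_irrefl)
  have "norm ?u \<le> 1 + e\<^sup>2 / 2"
  proof (rule power2_le_imp_le)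
    show "(norm ?u)\<^sup>2 \<le> (1 + e\<^sup>2 / 2)\<^sup>2"
      unfolding power2_norm_eq_inner u2 by (simp add: power2_sum power_divide)
  qed simp
  have "- v - e *\<^sub>R (- w) = - ?u" "- t - e * (- m') = - t + e * m'" by simp_all
  then have "(s - e * m) + (- t + e * m') \<le> (s - t) * norm ?u"
    using widest[OF u0 e0(2)[OF e(1,2)], of "- t + e * m'"] e1(2)[OF e(1,3)] by simp
  also have "\<dots> \<le> (s - t) * (1 + e\<^sup>2 / 2)"
    using \<open>norm ?u \<le> 1 + e\<^sup>2 / 2\<close> \<open>t \<le> s\<close> by (intro mult_left_mono) auto
  also have "\<dots> = (s - t) + e * (e * (s - t) / 2)" by (simp add: field_simps power2_eq_square)
  finally have "e * (m' - m) \<le> e * (e * (s - t) / 2)" by (simp add: right_diff_distrib)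
  then have "m' - m \<le> e * (s - t) / 2" using e by simp
  also have "\<dots> \<le> e * (s - t + 1)"
  proof -
    have "0 \<le> e * (s - t)" using e \<open>t \<le> s\<close> by simp
    then show ?thesis using e(1) by (simp add: distrib_left)
  qed
  also have "\<dots> < m' - m" using e(4) \<open>t \<le> s\<close> by (simp add: pos_less_divide_eq)
  finally show False by simp
qed

section \<open>Folding the cap behind the shorter chord\<close>

text \<open>Segments from \<open>x\<close> to the ends of the longer chord cross the shorter chord
  between \<open>p\<close> and \<open>q\<close>. Since the chords are nested, \<open>x\<close>
  itself lies over the shorter chord, and the height bound puts its mirror image on a vertical
  segment between the two chords.\<close>

lemma fold_in_trapezoid:
  assumes f: "frame v w" and K: "convex K" and ts: "t < s"
    and pq: "p *\<^sub>R w + s *\<^sub>R v \<in> K" "q *\<^sub>R w + s *\<^sub>R v \<in> K"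
      "\<And>x. x \<in> K \<Longrightarrow> v \<bullet> x = s \<Longrightarrow> p \<le> w \<bullet> x \<and> w \<bullet> x \<le> q"
    and pq': "p' *\<^sub>R w + t *\<^sub>R v \<in> K" "q' *\<^sub>R w + t *\<^sub>R v \<in> K" and nested: "p' \<le> p" "q \<le> q'"
    and height: "\<And>x. x \<in> K \<Longrightarrow> v \<bullet> x - s \<le> s - t" and x: "x \<in> cap K v s"
  shows "x - (2 * (v \<bullet> x - s)) *\<^sub>R v \<in> K"
proof -
  define X y where "X = w \<bullet> x" and "y = v \<bullet> x - s"
  have xK: "x \<in> K" and y0: "0 \<le> y" using x by (auto simp: cap_def y_def)
  have yt: "y \<le> s - t" using height[OF xK] by (simp add: y_def)
  \<comment> \<open>The weights bring a combination of \<open>x\<close>, at height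
    \<open>s + y\<close>, and a point at height \<open>t\<close> to height \<open>s\<close>.\<close>
  define a b where "a = (s - t) / (s - t + y)" and "b = y / (s - t + y)"
  have ab: "0 < a" "0 \<le> b" "a + b = 1" "a * y = b * (s - t)"
    using ts y0 by (simp_all add: a_def b_def add_divide_distrib[symmetric])
  have cross: "p \<le> a * X + b * r \<and> a * X + b * r \<le> q" if r: "r *\<^sub>R w + t *\<^sub>R v \<in> K" for r
  proof -
    let ?c = "a *\<^sub>R x + b *\<^sub>R (r *\<^sub>R w + t *\<^sub>R v)"
    have "?c \<in> K" by (rule convexD[OF K xK r]) (use ab in simp_all)
    moreover have "v \<bullet> ?c = s"
    proof -
      have "v \<bullet> ?c = a * (s + y) + b * t"
        unfolding inner_add_right[of v "a *\<^sub>R x"] inner_scaleR_right[of v a] inner_scaleR_right[of v b]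
          frame_inner(1)[OF f, of r t] by (simp add: y_def)
      also have "\<dots> = (a + b) * s + (a * y - b * (s - t))" by algebra
      finally show ?thesis using ab by simp
    qed
    moreover have "w \<bullet> ?c = a * X + b * r"
      unfolding inner_add_right[of w "a *\<^sub>R x"] inner_scaleR_right[of w a] inner_scaleR_right[of w b]
        frame_inner(2)[OF f, of r t] by (simp add: X_def)
    ultimately show ?thesis using pq(3)[of ?c] by simp
  qed
  have b: "b = 1 - a" using ab by simp
  have "a * p \<le> a * X"
  proof -
    have "b * p' \<le> b * p" using nested ab by (intro mult_left_mono)
    then show ?thesis using cross[OF pq'(1)] unfolding b by (simp add: algebra_simps)
  qed
  moreover have "a * X \<le> a * q"
  proof -
    have "b * q \<le> b * q'" using nested ab by (intro mult_left_mono)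
    then show ?thesis using cross[OF pq'(2)] unfolding b by (simp add: algebra_simps)
  qed
  ultimately have X: "p \<le> X" "X \<le> q" using ab by simp_all
  have "X *\<^sub>R w + s *\<^sub>R v \<in> K" by (rule convex_horizontal[OF K pq(1,2) X])
  moreover have "X *\<^sub>R w + t *\<^sub>R v \<in> K" by (rule convex_horizontal[OF K pq']) (use X nested in auto)
  ultimately have "t *\<^sub>R v + X *\<^sub>R w \<in> K" "s *\<^sub>R v + X *\<^sub>R w \<in> K" by (simp_all only: add.commute)
  then have "(s - y) *\<^sub>R v + X *\<^sub>R w \<in> K"
    by (rule convex_horizontal[OF K]) (use y0 yt in auto)
  moreover have "x - (2 * y) *\<^sub>R v = (s - y) *\<^sub>R v + X *\<^sub>R w"
  proof -
    have "x = X *\<^sub>R w + (s + y) *\<^sub>R v" using frame_expand[OF f, of x] by (simp add: X_def y_def)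
    moreover have "(2 * y) *\<^sub>R v = (s + y) *\<^sub>R v - (s - y) *\<^sub>R v"
      by (simp add: scaleR_diff_left[symmetric])
    ultimately show ?thesis by simp
  qed
  ultimately show ?thesis by (simp add: y_def)
qed

text \<open>The height bound is assumed in all directions, because neither the widest direction nor
  the side with the shorter chord is known in advance.\<close>

lemma fold_exists:
  fixes K :: "(real^2) set"
  assumes K: "compact K" "convex K" and a: "0 < a" "2 * a < measure lebesgue K"
    and height: "\<And>v x. norm v = 1 \<Longrightarrow> x \<in> K \<Longrightarrow> v \<bullet> x - level K a v \<le> level K a v + level K a (- v)"
  obtains v s where "norm v = 1" "measure lebesgue (cap K v s) = a"
    "\<And>x. x \<in> cap K v s \<Longrightarrow> x - (2 * (v \<bullet> x - s)) *\<^sub>R v \<in> K"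
proof -
  have aK: "a < measure lebesgue K" using a by simp
  obtain v where v: "norm v = 1" and widest: "\<And>u r t. u \<noteq> 0 \<Longrightarrow> a \<le> measure lebesgue (cap K u r) \<Longrightarrow>
      a \<le> measure lebesgue (cap K (- u) t) \<Longrightarrow> r + t \<le> (level K a v + level K a (- v)) * norm u"
    by (rule widest_strip[OF K(1) a(1) aK]) (rule that)
  have v0: "v \<noteq> 0" "- v \<noteq> 0" using v by auto
  define s t where "s = level K a v" and "t = - level K a (- v)"
  have ms: "measure lebesgue (cap K v s) = a" and mt: "measure lebesgue (cap K (- v) (- t)) = a"
    unfolding s_def t_def using measure_cap_level[OF K(1) _ a(1) aK] v0 by simp_all
  have widest': "r + r' \<le> (s - t) * norm u" if "u \<noteq> 0"
    "measure lebesgue (cap K v s) \<le> measure lebesgue (cap K u r)"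
    "measure lebesgue (cap K (- v) (- t)) \<le> measure lebesgue (cap K (- u) r')" for u r r'
    using widest[of u r r'] that unfolding ms mt by (simp add: s_def t_def)
  have ts: "t < s"
  proof (rule ccontr)
    assume "\<not> ?thesis"
    then have "measure lebesgue K \<le> a + a" using measure_le_opposite_caps[OF K(1), of s t v] ms mt by simp
    with a show False by simp
  qed
  obtain w where f: "frame v w" using frame_exists[OF v] .
  have f': "frame (- v) w" "frame v (- w)" using f by (simp_all add: frame_uminus)
  obtain z p q where z: "z \<in> interior K" "v \<bullet> z = s" and pq: "p < q"
    "p *\<^sub>R w + s *\<^sub>R v \<in> K" "q *\<^sub>R w + s *\<^sub>R v \<in> K"
    and bd: "\<And>x. x \<in> K \<Longrightarrow> v \<bullet> x = s \<Longrightarrow> p \<le> w \<bullet> x \<and> w \<bullet> x \<le> q"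
    by (rule chord_ends[OF f K, of s]) (use a ms in auto)
  obtain z' p' q' where z': "z' \<in> interior K" "- v \<bullet> z' = - t" and pq': "p' < q'"
    "p' *\<^sub>R w + (- t) *\<^sub>R (- v) \<in> K" "q' *\<^sub>R w + (- t) *\<^sub>R (- v) \<in> K"
    and bd': "\<And>x. x \<in> K \<Longrightarrow> - v \<bullet> x = - t \<Longrightarrow> p' \<le> w \<bullet> x \<and> w \<bullet> x \<le> q'"
    by (rule chord_ends[OF f'(1) K, of "- t"]) (use a mt in auto)
  have z'2: "v \<bullet> z' = t" and pq'2: "p' *\<^sub>R w + t *\<^sub>R v \<in> K" "q' *\<^sub>R w + t *\<^sub>R v \<in> K"
    and bd'2: "\<And>x. x \<in> K \<Longrightarrow> v \<bullet> x = t \<Longrightarrow> p' \<le> w \<bullet> x \<and> w \<bullet> x \<le> q'"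
    using z' pq' bd' by simp_all
  have "p' + q' \<le> p + q"
    by (rule widest_strip_midpoints[OF f K less_imp_le[OF ts] widest' z pq _ z'(1) z'2 pq'(1) pq'2])
      (use bd bd'2 in auto)
  \<comment> \<open>The reverse inequality comes from the same lemma with \<open>w\<close> reversed,
    so the midpoints agree and the shorter chord projects into the longer one.\<close>
  moreover have "- q' + - p' \<le> - q + - p"
    by (rule widest_strip_midpoints[OF f'(2) K less_imp_le[OF ts] widest' z _ _ _ _ z'(1) z'2])
      (use pq pq' pq'2 bd bd'2 in auto)
  ultimately have mid: "p + q = p' + q'" by simp
  show ?thesis
  proof (cases "q - p \<le> q' - p'")
    case True
    show ?thesis
    proof (rule that[OF v ms])
      fix x assume x: "x \<in> cap K v s"
      show "x - (2 * (v \<bullet> x - s)) *\<^sub>R v \<in> K"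
        by (rule fold_in_trapezoid[OF f K(2) ts pq(2,3) bd pq'2 _ _ _ x])
          (use True mid height[OF v] in \<open>auto simp: s_def t_def\<close>)
    qed
  next
    case False
    have ts': "- s < - t" and v': "norm (- v) = 1" using ts v by simp_all
    show ?thesis
    proof (rule that[OF v' mt])
      fix x assume x: "x \<in> cap K (- v) (- t)"
      show "x - (2 * (- v \<bullet> x - - t)) *\<^sub>R - v \<in> K"
        by (rule fold_in_trapezoid[OF f'(1) K(2) ts' pq'(2,3) bd' _ _ _ _ _ x, of p q])
          (use False mid pq height[OF v'] in \<open>auto simp: s_def t_def\<close>)
    qed
  qed
qed

section \<open>Lower bounds for the folding symmetry\<close>

text \<open>The homothety with centre \<open>T\<close> and ratio \<open>c\<close> takes the line at
  height \<open>s\<close> to the line at height \<open>l\<close>. By convexity its inverse maps the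
  larger cap into the smaller one, and areas scale by \<open>c\<^sup>2\<close>.\<close>

lemma cap_dilation:
  fixes K :: "(real^2) set"
  assumes K: "compact K" "convex K" and T: "T \<in> K" and ls: "l \<le> s" "s < v \<bullet> T"
    and top: "\<And>x. x \<in> K \<Longrightarrow> v \<bullet> x \<le> v \<bullet> T"
  shows "measure lebesgue (cap K v l) \<le> ((v \<bullet> T - l) / (v \<bullet> T - s))\<^sup>2 * measure lebesgue (cap K v s)"
proof -
  define c where "c = (v \<bullet> T - l) / (v \<bullet> T - s)"
  have c1: "1 \<le> c" and cs: "c * (v \<bullet> T - s) = v \<bullet> T - l" using ls by (simp_all add: c_def)
  let ?T = "\<lambda>x. (1 - c) *\<^sub>R T + c *\<^sub>R x"
  have "cap K v l \<subseteq> ?T ` cap K v s"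
  proof
    fix x assume x: "x \<in> cap K v l"
    define y where "y = (1 - 1 / c) *\<^sub>R T + (1 / c) *\<^sub>R x"
    have "y \<in> K" unfolding y_def using x c1 T by (intro convexD_alt[OF K(2)]) (auto simp: cap_def)
    moreover have "s \<le> v \<bullet> y"
    proof -
      have "c * (v \<bullet> y) = (c - 1) * (v \<bullet> T) + v \<bullet> x"
        using c1 by (simp add: y_def inner_add_right algebra_simps)
      moreover have "l \<le> v \<bullet> x" using x by (simp add: cap_def)
      ultimately have "c * s \<le> c * (v \<bullet> y)" using cs by (simp add: algebra_simps)
      then show ?thesis using c1 by simp
    qed
    moreover have "x = ?T y"
      using c1 by (simp add: y_def scaleR_add_right right_diff_distrib scaleR_add_left[symmetric])
    ultimately show "x \<in> ?T ` cap K v s" by (auto simp: cap_def)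
  qed
  then have "measure lebesgue (cap K v l) \<le> measure lebesgue (?T ` cap K v s)"
  proof (rule measure_mono_fmeasurable)
    have "compact (?T ` cap K v s)"
      using compact_cap[OF K(1)] by (intro compact_continuous_image continuous_intros)
    then show "?T ` cap K v s \<in> lmeasurable" by (rule lmeasurable_compact)
  qed (use K in \<open>simp add: fmeasurableD\<close>)
  also have "\<dots> = c\<^sup>2 * measure lebesgue (cap K v s)"
    using measure_lebesgue_affine[of c "(1 - c) *\<^sub>R T" "cap K v s"]
    by (simp add: add.commute power2_eq_square)
  finally show ?thesis by (simp add: c_def)
qed

lemma convex_body_measure_pos:
  assumes "convex_body K"
  shows "0 < measure lebesgue K"
proof -
  have "\<not> negligible K"
    using assms negligible_convex_interior[of K] by (auto simp: convex_body_def)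
  then show ?thesis
    using assms lmeasurable_compact[of K] by (auto simp: convex_body_def negligible_iff_measure zero_less_measure_iff)
qed

text \<open>If the cap were higher than the strip is wide, dilating it with ratio less than 2 would
  cover the cap and the strip together. These have area at least \<open>4 * a\<close>, which
  requires ratio at least 2.\<close>

lemma level_height:
  fixes K :: "(real^2) set"
  assumes K: "compact K" "convex K" and a: "0 < a" "5 * a \<le> measure lebesgue K"
    and v: "norm v = 1" and x: "x \<in> K"
  shows "v \<bullet> x - level K a v \<le> level K a v + level K a (- v)"
proof -
  define s t where "s = level K a v" and "t = - level K a (- v)"
  have v0: "v \<noteq> 0" "- v \<noteq> 0" using v by auto
  have aK: "a < measure lebesgue K" using a by simp
  have ms: "measure lebesgue (cap K v s) = a" and mt: "measure lebesgue (cap K (- v) (- t)) = a"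
    unfolding s_def t_def using measure_cap_level[OF K(1) _ a(1) aK] v0 by simp_all
  have ts: "t < s"
  proof (rule ccontr)
    assume "\<not> ?thesis"
    then have "measure lebesgue K \<le> a + a" using measure_le_opposite_caps[OF K(1), of s t v] ms mt by simp
    with a show False by simp
  qed
  have Kt: "4 * a \<le> measure lebesgue (cap K v t)"
    using measure_le_opposite_caps[OF K(1), of t t v] mt a by simp
  obtain T where T: "T \<in> K" and top: "\<And>x. x \<in> K \<Longrightarrow> v \<bullet> x \<le> v \<bullet> T"
    using continuous_attains_sup[OF K(1), of "\<lambda>x. v \<bullet> x"] x continuous_on_inner[OF continuous_on_const continuous_on_id] by blast
  have "v \<bullet> T - s \<le> s - t"
  proof (rule ccontr)
    assume less: "\<not> ?thesis"
    with ts have sT: "s < v \<bullet> T" by simp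
    let ?c = "(v \<bullet> T - t) / (v \<bullet> T - s)"
    have "4 * a \<le> ?c\<^sup>2 * a"
      using cap_dilation[OF K T less_imp_le[OF ts] sT top] Kt by (simp add: ms)
    then have "2\<^sup>2 \<le> ?c\<^sup>2" using a by simp
    then have "2 \<le> ?c" by (rule power2_le_imp_le) (use ts sT in simp)
    then show False using less sT by (simp add: pos_le_divide_eq)
  qed
  then show ?thesis using top[OF x] by (simp add: s_def t_def)
qed

text \<open>By symmetry the line through the centre bisects the strip, so the cap is compared with
  half of \<open>K\<close>. That half has area at least \<open>9 / 4 * a\<close>, whereas a cap
  higher than the strip is wide would give a ratio less than 3/2.\<close>

lemma level_height_centrally_symmetric:
  fixes K :: "(real^2) set"
  assumes K: "compact K" "convex K" and a: "0 < a" "9 * a \<le> 2 * measure lebesgue K"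
    and sym: "\<And>x. x \<in> K \<Longrightarrow> 2 *\<^sub>R c - x \<in> K"
    and v: "norm v = 1" and x: "x \<in> K"
  shows "v \<bullet> x - level K a v \<le> level K a v + level K a (- v)"
proof -
  define s where "s = level K a v"
  have v0: "v \<noteq> 0" "- v \<noteq> 0" using v by auto
  have aK: "a < measure lebesgue K" using a by simp
  have ms: "measure lebesgue (cap K v s) = a"
    unfolding s_def by (rule measure_cap_level[OF K(1) v0(1) a(1) aK])
  have refl: "measure lebesgue (cap K (- v) r) = measure lebesgue (cap K v (r + 2 * (v \<bullet> c)))" for r
  proof -
    have "cap K (- v) r = (\<lambda>x. 2 *\<^sub>R c - x) ` cap K v (r + 2 * (v \<bullet> c))"
    proof (intro equalityI subsetI)
      fix x assume "x \<in> cap K (- v) r"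
      then have "2 *\<^sub>R c - x \<in> cap K v (r + 2 * (v \<bullet> c))"
        using sym by (auto simp: cap_def inner_diff_right)
      moreover have "x = 2 *\<^sub>R c - (2 *\<^sub>R c - x)" by simp
      ultimately show "x \<in> (\<lambda>x. 2 *\<^sub>R c - x) ` cap K v (r + 2 * (v \<bullet> c))" by blast
    qed (use sym in \<open>auto simp: cap_def inner_diff_right\<close>)
    then show ?thesis using measure_point_reflection[OF lmeasurable_cap[OF K(1)]] by simp
  qed
  \<comment> \<open>The point reflection about \<open>c\<close> carries the cap at height
    \<open>s\<close> to an opposite cap of the same area, which bounds the opposite level from
    below.\<close>
  have opp: "s - 2 * (v \<bullet> c) \<le> level K a (- v)"
    by (rule le_level[OF K(1) v0(2) a(1) aK]) (simp add: refl ms)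
  have half: "measure lebesgue K \<le> 2 * measure lebesgue (cap K v (v \<bullet> c))"
    using measure_le_opposite_caps[OF K(1), of "v \<bullet> c" "v \<bullet> c" v] by (simp add: refl)
  have cs: "v \<bullet> c < s"
  proof (rule ccontr)
    assume "\<not> ?thesis"
    then have "measure lebesgue (cap K v (v \<bullet> c)) \<le> a"
      using measure_cap_antimono[OF K(1), of s "v \<bullet> c" v] ms by simp
    with half a show False by simp
  qed
  obtain T where T: "T \<in> K" and top: "\<And>x. x \<in> K \<Longrightarrow> v \<bullet> x \<le> v \<bullet> T"
    using continuous_attains_sup[OF K(1), of "\<lambda>x. v \<bullet> x"] x continuous_on_inner[OF continuous_on_const continuous_on_id] by blast
  have "v \<bullet> T - s \<le> 2 * (s - v \<bullet> c)"
  proof (rule ccontr)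
    assume less: "\<not> ?thesis"
    with cs have sT: "s < v \<bullet> T" by simp
    define k where "k = (v \<bullet> T - v \<bullet> c) / (v \<bullet> T - s)"
    have "measure lebesgue (cap K v (v \<bullet> c)) \<le> k\<^sup>2 * a"
      unfolding k_def using cap_dilation[OF K T less_imp_le[OF cs] sT top] by (simp only: ms)
    with half a have "9 / 4 * a \<le> k\<^sup>2 * a" by linarith
    then have "9 / 4 \<le> k\<^sup>2" using a(1) by (simp only: mult_le_cancel_right_pos)
    then have "(3 / 2)\<^sup>2 \<le> k\<^sup>2" by (simp add: power_divide)
    then have "3 / 2 \<le> k" by (rule power2_le_imp_le) (use cs sT in \<open>simp add: k_def\<close>)
    then show False using less sT by (simp add: k_def pos_le_divide_eq)
  qed
  then show ?thesis using top[OF x] opp by (simp add: s_def)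
qed

section \<open>From folds to bounds on the folding symmetry\<close>

lemma bdd_above_folds:
  fixes K :: "'a::euclidean_space set"
  assumes "compact K"
  shows "bdd_above {measure lebesgue (K \<inter> closed_halfspace a b) | a b.
    a \<noteq> 0 \<and> refl_hyp a b ` (K \<inter> closed_halfspace a b) \<subseteq> K}"
proof (rule bdd_aboveI)
  fix y assume "y \<in> {measure lebesgue (K \<inter> closed_halfspace a b) | a b.
    a \<noteq> 0 \<and> refl_hyp a b ` (K \<inter> closed_halfspace a b) \<subseteq> K}"
  then obtain a b where y: "y = measure lebesgue (K \<inter> closed_halfspace a b)" by blast
  have "compact (K \<inter> closed_halfspace a b)"
    unfolding closed_halfspace_def by (intro compact_Int_closed assms closed_halfspace_le)
  then show "y \<le> measure lebesgue K" unfolding y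
    by (intro measure_mono_fmeasurable) (auto intro: fmeasurableD lmeasurable_compact assms)
qed

lemma sym_fold_ge:
  fixes K :: "'a::euclidean_space set"
  assumes K: "compact K" "0 < measure lebesgue K"
    and fold: "a \<noteq> 0" "refl_hyp a b ` (K \<inter> closed_halfspace a b) \<subseteq> K"
    and c: "c * measure lebesgue K \<le> 2 * measure lebesgue (K \<inter> closed_halfspace a b)"
  shows "c \<le> sym_fold K"
proof -
  have "measure lebesgue (K \<inter> closed_halfspace a b) \<le> Sup {measure lebesgue (K \<inter> closed_halfspace a b) | a b.
    a \<noteq> 0 \<and> refl_hyp a b ` (K \<inter> closed_halfspace a b) \<subseteq> K}" (is "_ \<le> ?S")
    by (rule cSup_upper[OF _ bdd_above_folds[OF K(1)]]) (use fold in blast)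
  with c have "c * measure lebesgue K \<le> 2 * ?S" by linarith
  then have "c \<le> 2 * ?S / measure lebesgue K" using K(2) by (simp add: pos_le_divide_eq)
  then show ?thesis by (simp add: sym_fold_def)
qed

lemma sym_fold_ge_of_height:
  fixes K :: "(real^2) set"
  assumes K: "convex_body K" and a: "0 < a" "2 * a < measure lebesgue K"
    and height: "\<And>v x. norm v = 1 \<Longrightarrow> x \<in> K \<Longrightarrow> v \<bullet> x - level K a v \<le> level K a v + level K a (- v)"
  shows "2 * a / measure lebesgue K \<le> sym_fold K"
proof -
  have K': "compact K" "convex K" using K by (auto simp: convex_body_def)
  obtain v s where v: "norm v = 1" and ms: "measure lebesgue (cap K v s) = a"
    and fold: "\<And>x. x \<in> cap K v s \<Longrightarrow> x - (2 * (v \<bullet> x - s)) *\<^sub>R v \<in> K"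
    by (rule fold_exists[OF K' a height]) (auto intro: that)
  \<comment> \<open>Caps are upper halfspaces and \<open>closed_halfspace\<close> a lower one, hence
    the negated normal and bound.\<close>
  have cap: "K \<inter> closed_halfspace (- v) (- s) = cap K v s"
    by (auto simp: closed_halfspace_def cap_def)
  have "v \<bullet> v = 1" using v by (simp add: norm_eq_1)
  then have "refl_hyp (- v) (- s) x = x - (2 * (v \<bullet> x - s)) *\<^sub>R v" for x
    by (simp add: refl_hyp_def algebra_simps)
  then show ?thesis
    using convex_body_measure_pos[OF K] ms v fold
    by (intro sym_fold_ge[OF K'(1), of "- v" "- s"]) (auto simp: cap)
qed

lemma sym_fold_ge_3_8:
  fixes K :: "(real^2) set"
  assumes K: "convex_body K"
  shows "3 / 8 \<le> sym_fold K"
proof -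
  have M: "0 < measure lebesgue K" by (rule convex_body_measure_pos[OF K])
  have K': "compact K" "convex K" using K by (auto simp: convex_body_def)
  \<comment> \<open>Folding off 3/16 of the area gives 3/8, and 5 * 3/16 is at most 1.\<close>
  have "2 * (3 / 16 * measure lebesgue K) / measure lebesgue K \<le> sym_fold K"
    by (rule sym_fold_ge_of_height[OF K]) (use M in simp, use M in simp, rule level_height[OF K'], use M in simp_all)
  then show ?thesis using M by simp
qed

lemma sym_fold_ge_4_9:
  fixes K :: "(real^2) set"
  assumes K: "convex_body K" and "centrally_symmetric K"
  shows "4 / 9 \<le> sym_fold K"
proof -
  obtain c where c: "\<And>x. x \<in> K \<Longrightarrow> 2 *\<^sub>R c - x \<in> K"
    using assms(2) by (auto simp: centrally_symmetric_def)
  have M: "0 < measure lebesgue K" by (rule convex_body_measure_pos[OF K])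
  have K': "compact K" "convex K" using K by (auto simp: convex_body_def)
  \<comment> \<open>Folding off 2/9 of the area gives 4/9 and meets the bound
    \<open>9 * a \<le> 2 * measure lebesgue K\<close> with equality.\<close>
  have "2 * (2 / 9 * measure lebesgue K) / measure lebesgue K \<le> sym_fold K"
    by (rule sym_fold_ge_of_height[OF K])
      (use M in simp, use M in simp, rule level_height_centrally_symmetric[OF K' _ _ c], use M in simp_all)
  then show ?thesis using M by simp
qed

section \<open>Folds of a thin parallelogram\<close>

text \<open>The point reflection about the centre exchanges the two sides: the open half and its
  image are disjoint, the closed half and its image cover the box.\<close>

lemma measure_half_cbox:
  fixes m k g :: "real^2"
  assumes "g \<noteq> 0"
  shows "measure lebesgue (cap (cbox (m - k) (m + k)) g (g \<bullet> m)) = measure lebesgue (cbox (m - k) (m + k)) / 2"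
proof -
  let ?B = "cbox (m - k) (m + k)"
  let ?O = "?B \<inter> {x. g \<bullet> m < g \<bullet> x}" and ?C = "cap ?B g (g \<bullet> m)"
  let ?r = "\<lambda>x. 2 *\<^sub>R m - x"
  have B: "compact ?B" by (rule compact_cbox)
  have rB: "?r x \<in> ?B" if "x \<in> ?B" for x
    using that by (simp add: mem_box_cart) (smt (verit, best))
  have O: "?O \<in> lmeasurable" by (rule lmeasurable_cap_open[OF B])
  have eq: "measure lebesgue ?O = measure lebesgue ?C" by (rule measure_cap_open[OF B assms])
  have "measure lebesgue (?O \<union> ?r ` ?O) = measure lebesgue ?O + measure lebesgue (?r ` ?O)"
  proof -
    have "?r ` ?O - ?O = ?r ` ?O" by (auto simp: inner_diff_right)
    then show ?thesis by (simp add: measure_Un2[OF O lmeasurable_point_reflection[OF O]])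
  qed
  moreover have "measure lebesgue (?O \<union> ?r ` ?O) \<le> measure lebesgue ?B"
    using rB by (intro measure_mono_fmeasurable)
      (auto intro!: fmeasurableD[OF fmeasurable.Un[OF O lmeasurable_point_reflection[OF O]]])
  ultimately have "2 * measure lebesgue ?C \<le> measure lebesgue ?B"
    by (simp add: measure_point_reflection[OF O] eq)
  moreover have "measure lebesgue ?B \<le> 2 * measure lebesgue ?C"
  proof -
    have "cap ?B (- g) (- (g \<bullet> m)) \<subseteq> ?r ` ?C"
    proof
      fix x assume "x \<in> cap ?B (- g) (- (g \<bullet> m))"
      then have "?r x \<in> ?C" using rB by (auto simp: cap_def inner_diff_right)
      then show "x \<in> ?r ` ?C" by (intro image_eqI[of _ _ "?r x"]) simp_all
    qed
    then have "measure lebesgue (cap ?B (- g) (- (g \<bullet> m))) \<le> measure lebesgue (?r ` ?C)"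
      using B by (intro measure_mono_fmeasurable) (simp_all add: fmeasurableD lmeasurable_point_reflection)
    then show ?thesis
      using measure_le_opposite_caps[OF B, of "g \<bullet> m" "g \<bullet> m" g] B
      by (simp add: measure_point_reflection)
  qed
  ultimately show ?thesis by simp
qed

lemma measure_cbox_centred:
  fixes m k :: "real^2"
  assumes "0 \<le> k$1" "0 \<le> k$2"
  shows "measure lebesgue (cbox (m - k) (m + k)) = 4 * k$1 * k$2"
proof -
  have "cbox (m - k) (m + k) \<noteq> {}"
    using assms by (auto simp: interval_ne_empty_cart forall_2)
  then have "measure lborel (cbox (m - k) (m + k)) = 4 * k$1 * k$2"
    by (simp add: content_cbox_cart UNIV_2)
  then show ?thesis by simp
qed

abbreviation square :: "(real^2) set" where "square \<equiv> cbox (- 1) 1"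

lemma mem_square: "x \<in> square \<longleftrightarrow> \<bar>x$1\<bar> \<le> 1 \<and> \<bar>x$2\<bar> \<le> 1"
  by (auto simp: mem_box_cart forall_2)

lemma mem_cbox_centred:
  fixes m k :: "real^2"
  shows "x \<in> cbox (m - k) (m + k) \<longleftrightarrow> \<bar>x$1 - m$1\<bar> \<le> k$1 \<and> \<bar>x$2 - m$2\<bar> \<le> k$2"
  by (auto simp: mem_box_cart forall_2 abs_le_iff algebra_simps)

lemma inner_vector2: "(vector [A, B] :: real^2) \<bullet> x = A * x$1 + B * x$2"
  by (simp add: inner_vec_def sum_2)

text \<open>A cap contained in a box whose centre lies on the cutting line is contained in half of
  that box. This replaces the integration of triangles and trapezoids.\<close>

lemma measure_square_cap_le:
  fixes m k :: "real^2"
  assumes "A \<noteq> 0 \<or> B \<noteq> 0" "0 \<le> k$1" "0 \<le> k$2" "A * m$1 + B * m$2 = b"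
    and "\<And>x :: real^2. \<bar>x$1\<bar> \<le> 1 \<Longrightarrow> \<bar>x$2\<bar> \<le> 1 \<Longrightarrow> b \<le> A * x$1 + B * x$2 \<Longrightarrow>
      \<bar>x$1 - m$1\<bar> \<le> k$1 \<and> \<bar>x$2 - m$2\<bar> \<le> k$2"
  shows "measure lebesgue (cap square (vector [A, B]) b) \<le> 2 * k$1 * k$2"
proof -
  let ?g = "vector [A, B] :: real^2"
  have g0: "?g \<noteq> 0" using assms(1) by (auto simp: vec_eq_iff forall_2)
  have gm: "?g \<bullet> m = b" using assms(4) by (simp add: inner_vector2)
  have "cap square ?g b \<subseteq> cap (cbox (m - k) (m + k)) ?g (?g \<bullet> m)"
    unfolding gm using assms(5) by (auto simp: cap_def mem_square mem_cbox_centred inner_vector2)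
  then have "measure lebesgue (cap square ?g b) \<le> measure lebesgue (cap (cbox (m - k) (m + k)) ?g (?g \<bullet> m))"
    by (intro measure_mono_fmeasurable) (simp_all add: fmeasurableD)
  also have "\<dots> = 2 * k$1 * k$2"
    by (simp only: measure_half_cbox[OF g0] measure_cbox_centred[OF assms(2,3)])
  finally show ?thesis .
qed

text \<open>The functional takes its maximum \<open>\<alpha> + \<beta>\<close> over the square at
  the vertex \<open>(\<sigma>, \<tau>)\<close>, and \<open>h\<close> is the depth of the cut below
  it. The bound is the area of the right triangle with legs \<open>h / \<alpha>\<close> and
  \<open>h / \<beta>\<close>; the box spanned by these legs has its centre on the
  hypotenuse.\<close>

lemma corner_cap_le:
  assumes \<sigma>: "\<bar>\<sigma>\<bar> = 1" and \<tau>: "\<bar>\<tau>\<bar> = 1" and pos: "0 < \<alpha>" "0 < \<beta>" "0 \<le> h"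
  shows "measure lebesgue (cap square (vector [\<sigma> * \<alpha>, \<tau> * \<beta>]) (\<alpha> + \<beta> - h)) \<le> h\<^sup>2 / (2 * \<alpha> * \<beta>)"
proof -
  define m k :: "real^2" where "m = vector [\<sigma> * (1 - h / (2 * \<alpha>)), \<tau> * (1 - h / (2 * \<beta>))]"
    and "k = vector [h / (2 * \<alpha>), h / (2 * \<beta>)]"
  have \<sigma>': "\<sigma> = 1 \<or> \<sigma> = - 1" and \<tau>': "\<tau> = 1 \<or> \<tau> = - 1" using \<sigma> \<tau> by auto
  have bound: "1 - h / \<gamma> \<le> y" if "0 < \<gamma>" "0 \<le> \<delta>" "\<gamma> + \<delta> - h \<le> \<gamma> * y + \<delta> * z" "z \<le> 1" for \<gamma> \<delta> y z :: real
  proof -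
    have "\<delta> * z \<le> \<delta> * 1" by (rule mult_left_mono) (use that in auto)
    then have "\<gamma> * (1 - h / \<gamma>) \<le> \<gamma> * y" using that by (simp add: right_diff_distrib)
    then show ?thesis using that by (simp only: mult_le_cancel_left_pos)
  qed
  have "measure lebesgue (cap square (vector [\<sigma> * \<alpha>, \<tau> * \<beta>]) (\<alpha> + \<beta> - h)) \<le> 2 * k$1 * k$2"
  proof (rule measure_square_cap_le[of _ _ k m])
    show "\<sigma> * \<alpha> * m$1 + \<tau> * \<beta> * m$2 = \<alpha> + \<beta> - h"
      using \<sigma>' \<tau>' pos by (auto simp: m_def field_simps)
    fix x :: "real^2" assume x: "\<bar>x$1\<bar> \<le> 1" "\<bar>x$2\<bar> \<le> 1" "\<alpha> + \<beta> - h \<le> \<sigma> * \<alpha> * x$1 + \<tau> * \<beta> * x$2"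
    define y z where "y = \<sigma> * x$1" and "z = \<tau> * x$2"
    have yz: "y \<le> 1" "z \<le> 1" "\<alpha> + \<beta> - h \<le> \<alpha> * y + \<beta> * z" "\<beta> + \<alpha> - h \<le> \<beta> * z + \<alpha> * y"
      using x \<sigma>' \<tau>' by (auto simp: y_def z_def)
    have "1 - h / \<alpha> \<le> y" by (rule bound[OF _ _ yz(3,2)]) (use pos in auto)
    moreover have "1 - h / \<beta> \<le> z" by (rule bound[OF _ _ yz(4,1)]) (use pos in auto)
    moreover have "h / \<alpha> = 2 * (h / (2 * \<alpha>))" "h / \<beta> = 2 * (h / (2 * \<beta>))" using pos by simp_all
    ultimately have "\<bar>y - (1 - h / (2 * \<alpha>))\<bar> \<le> h / (2 * \<alpha>)" "\<bar>z - (1 - h / (2 * \<beta>))\<bar> \<le> h / (2 * \<beta>)"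
      using yz by linarith+
    then show "\<bar>x$1 - m$1\<bar> \<le> k$1 \<and> \<bar>x$2 - m$2\<bar> \<le> k$2"
      using \<sigma>' \<tau>' by (auto simp: m_def k_def y_def z_def)
  qed (use pos \<sigma> in \<open>auto simp: k_def\<close>)
  also have "\<dots> = h\<^sup>2 / (2 * \<alpha> * \<beta>)" by (simp add: k_def power2_eq_square)
  finally show ?thesis .
qed

text \<open>For \<open>2 * \<beta> \<le> h\<close> the widths of the cut along the two horizontal
  sides are \<open>h / \<alpha>\<close> and \<open>(h - 2 * \<beta>) / \<alpha>\<close>. Their mean
  is the number \<open>r\<close> below, and the box of width \<open>2 * r\<close> and height 2
  contains the cap.\<close>

lemma side_cap_le:
  assumes \<sigma>: "\<bar>\<sigma>\<bar> = 1" and \<tau>: "\<bar>\<tau>\<bar> = 1" and pos: "0 < \<alpha>" "0 \<le> \<beta>" "2 * \<beta> \<le> h"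
  shows "measure lebesgue (cap square (vector [\<sigma> * \<alpha>, \<tau> * \<beta>]) (\<alpha> + \<beta> - h)) \<le> 2 * (h - \<beta>) / \<alpha>"
proof -
  define r where "r = (h - \<beta>) / \<alpha>"
  have r: "\<alpha> * r = h - \<beta>" "0 \<le> r" using pos by (simp_all add: r_def)
  define m k :: "real^2" where "m = vector [\<sigma> * (1 - r), 0]" and "k = vector [r, 1]"
  have \<sigma>': "\<sigma> = 1 \<or> \<sigma> = - 1" and \<tau>': "\<tau> = 1 \<or> \<tau> = - 1" using \<sigma> \<tau> by auto
  have "measure lebesgue (cap square (vector [\<sigma> * \<alpha>, \<tau> * \<beta>]) (\<alpha> + \<beta> - h)) \<le> 2 * k$1 * k$2"
  proof (rule measure_square_cap_le[of _ _ k m])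
    show "\<sigma> * \<alpha> * m$1 + \<tau> * \<beta> * m$2 = \<alpha> + \<beta> - h"
      using \<sigma>' r by (auto simp: m_def algebra_simps)
    fix x :: "real^2" assume x: "\<bar>x$1\<bar> \<le> 1" "\<bar>x$2\<bar> \<le> 1" "\<alpha> + \<beta> - h \<le> \<sigma> * \<alpha> * x$1 + \<tau> * \<beta> * x$2"
    define y z where "y = \<sigma> * x$1" and "z = \<tau> * x$2"
    have yz: "y \<le> 1" "z \<le> 1" "\<alpha> + \<beta> - h \<le> \<alpha> * y + \<beta> * z"
      using x \<sigma>' \<tau>' by (auto simp: y_def z_def)
    have "\<beta> * z \<le> \<beta> * 1" by (rule mult_left_mono) (use yz pos in auto)
    with yz have "\<alpha> - h \<le> \<alpha> * y" by simp
    then have "\<alpha> * (1 - 2 * r) \<le> \<alpha> * y" using r pos by (simp add: algebra_simps)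
    then have "1 - 2 * r \<le> y" using pos by (simp only: mult_le_cancel_left_pos)
    then have "\<bar>y - (1 - r)\<bar> \<le> r" using yz by linarith
    then show "\<bar>x$1 - m$1\<bar> \<le> k$1 \<and> \<bar>x$2 - m$2\<bar> \<le> k$2"
      using \<sigma>' x by (auto simp: m_def k_def y_def)
  qed (use pos r \<sigma> in \<open>auto simp: k_def\<close>)
  also have "\<dots> = 2 * (h - \<beta>) / \<alpha>" by (simp add: k_def r_def)
  finally show ?thesis .
qed

text \<open>Here \<open>X\<close> and \<open>Y\<close> stand for \<open>\<alpha> / h\<close> and
  \<open>\<beta> / h\<close>, so a folded triangle has area at most
  \<open>1 / (2 * (X * Y))\<close>. The fold condition forces \<open>Y + \<rho> * X\<close> to be at
  least 1 up to an error in \<open>\<delta>\<^sup>2\<close>; what remains is concave in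
  \<open>X\<close> and smallest at \<open>X = 1 / 2\<close>.\<close>

lemma fold_product_ge:
  fixes X Y \<rho> \<delta> :: real
  assumes XY: "1 / 2 \<le> X" "1 / 2 \<le> Y" and \<rho>: "0 < \<rho>" "\<rho> \<le> 1 / 2"
    and fold: "Y + \<rho> * X \<le> (Y + \<rho> * X)\<^sup>2 + \<delta>\<^sup>2 * X\<^sup>2"
  shows "(1 - \<rho> / 2) / 2 - 2 * \<delta>\<^sup>2 \<le> X * Y"
proof (cases "1 \<le> X")
  case True
  then have "1 * (1 / 2) \<le> X * Y" by (rule mult_mono) (use XY in auto)
  then have "1 / 2 \<le> X * Y" by simp
  have "(1 - \<rho> / 2) / 2 - 2 * D \<le> 1 / 2" if "0 \<le> D" for D
    using that \<rho> by (simp add: diff_divide_distrib)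
  from this[OF zero_le_power2] show ?thesis using \<open>1 / 2 \<le> X * Y\<close> by (rule order_trans)
next
  case False
  define Z D where "Z = Y + \<rho> * X" and "D = \<delta>\<^sup>2"
  have D0: "0 \<le> D" by (simp add: D_def)
  have "X\<^sup>2 \<le> 1" using False XY by (simp add: power_le_one)
  then have "D * X\<^sup>2 \<le> D" using D0 mult_left_le by blast
  then have ZD: "Z * (1 - Z) \<le> D" using fold by (simp add: Z_def D_def right_diff_distrib power2_eq_square)
  have "0 \<le> \<rho> * X" using \<rho> XY by simp
  then have Z2: "1 / 2 \<le> Z" using XY unfolding Z_def by linarith
  have "1 - 2 * D \<le> Z"
  proof (cases "Z \<le> 1")
    case True
    then have "1 / 2 * (1 - Z) \<le> Z * (1 - Z)" using Z2 by (intro mult_right_mono) auto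
    from order_trans[OF this ZD] show ?thesis by (simp add: field_simps)
  qed (use D0 in linarith)
  then have "X * (1 - 2 * D - \<rho> * X) \<le> X * Y" using XY by (intro mult_left_mono) (auto simp: Z_def)
  \<comment> \<open>The product is the difference between \<open>X * (1 - \<rho> * X)\<close> and
    its value at 1/2.\<close>
  moreover have "0 \<le> (X - 1 / 2) * (1 - \<rho> * (X + 1 / 2))"
  proof (rule mult_nonneg_nonneg)
    have "\<rho> * (X + 1 / 2) \<le> 1 / 2 * 2" using \<rho> False XY by (intro mult_mono) auto
    then show "0 \<le> 1 - \<rho> * (X + 1 / 2)" by simp
  qed (use XY in simp)
  moreover have "D * X \<le> D * 1" using D0 False by (intro mult_left_mono) auto
  moreover have "X * (1 - 2 * D - \<rho> * X) = (1 - \<rho> / 2) / 2 + (X - 1 / 2) * (1 - \<rho> * (X + 1 / 2)) - 2 * (D * X)"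
    by (simp add: field_simps)
  ultimately show ?thesis by (simp add: D_def)
qed

text \<open>The fold is written in the coordinates of a parallelogram with sides \<open>(1, 0)\<close> and
  \<open>(\<rho>, \<delta>)\<close>: the part folded over is \<open>A x\<^sub>1 + B x\<^sub>2 \<ge> b\<close>, and \<open>d\<close> is the direction orthogonal
  to the line. The quadratic condition on \<open>\<rho>\<close> makes the two extreme folds, a quadrilateral cut
  orthogonally to the long side and a triangle, have equal area as \<open>\<delta>\<close> tends to 0.\<close>

lemma measure_square_fold_le:
  fixes \<rho> \<delta> A B b :: real
  defines "d\<^sub>1 \<equiv> (\<rho>\<^sup>2 + \<delta>\<^sup>2) * A - \<rho> * B" and "d\<^sub>2 \<equiv> B - \<rho> * A"
  defines "n \<equiv> A * d\<^sub>1 + B * d\<^sub>2"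
  assumes \<rho>: "0 < \<rho>" "\<rho> \<le> 1 / 2" "\<rho>\<^sup>2 = 3 * \<rho> - 1" and \<delta>: "0 < \<delta>" "\<delta>\<^sup>2 + \<rho>\<^sup>2 \<le> \<rho> * (1 - \<rho>)" "4 * \<delta>\<^sup>2 < 1 - \<rho> / 2"
    and AB: "A \<noteq> 0 \<or> B \<noteq> 0"
    and fold: "\<And>x\<^sub>1 x\<^sub>2. \<bar>x\<^sub>1\<bar> \<le> 1 \<Longrightarrow> \<bar>x\<^sub>2\<bar> \<le> 1 \<Longrightarrow> b \<le> A * x\<^sub>1 + B * x\<^sub>2 \<Longrightarrow>
      \<bar>x\<^sub>1 - 2 * (A * x\<^sub>1 + B * x\<^sub>2 - b) / n * d\<^sub>1\<bar> \<le> 1 \<and> \<bar>x\<^sub>2 - 2 * (A * x\<^sub>1 + B * x\<^sub>2 - b) / n * d\<^sub>2\<bar> \<le> 1"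
  shows "measure lebesgue (cap square (vector [A, B]) b) \<le> 1 / (1 - \<rho> / 2 - 4 * \<delta>\<^sup>2)"
proof -
  \<comment> \<open>Reflecting the coordinates makes both coefficients nonnegative, so that the cap
    contains the vertex \<open>(1, 1)\<close>, if anything. The price is an undetermined sign of the
    mixed coefficient \<open>F\<close>.\<close>
  have "\<exists>\<sigma> \<alpha>. A = \<sigma> * \<alpha> \<and> \<bar>\<sigma>\<bar> = 1 \<and> 0 \<le> \<alpha>" for A :: real
    by (rule exI[of _ "if A < 0 then - 1 else 1"], rule exI[of _ "\<bar>A\<bar>"]) simp
  then obtain \<sigma> \<alpha> \<tau> \<beta> where A: "A = \<sigma> * \<alpha>" "\<bar>\<sigma>\<bar> = 1" "0 \<le> \<alpha>" and B: "B = \<tau> * \<beta>" "\<bar>\<tau>\<bar> = 1" "0 \<le> \<beta>"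
    by metis
  have \<sigma>\<tau>: "\<sigma> = 1 \<or> \<sigma> = - 1" "\<tau> = 1 \<or> \<tau> = - 1" using A B by auto
  \<comment> \<open>The Gram matrix of the sides has the entries 1, \<open>F\<close>,
    \<open>H\<close> after the change of signs, and \<open>(e\<^sub>1, e\<^sub>2)\<close> is its
    adjugate applied to \<open>(\<alpha>, \<beta>)\<close>.\<close>
  define F H where "F = \<rho> * \<sigma> * \<tau>" and "H = \<rho>\<^sup>2 + \<delta>\<^sup>2"
  define e\<^sub>1 e\<^sub>2 where "e\<^sub>1 = H * \<alpha> - F * \<beta>" and "e\<^sub>2 = \<beta> - F * \<alpha>"
  have d: "d\<^sub>1 = \<sigma> * e\<^sub>1" "d\<^sub>2 = \<tau> * e\<^sub>2"
    using \<sigma>\<tau> by (auto simp: d\<^sub>1_def d\<^sub>2_def e\<^sub>1_def e\<^sub>2_def A B F_def H_def algebra_simps)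
  have F: "F = \<rho> \<or> F = - \<rho>" using \<sigma>\<tau> by (auto simp: F_def)
  then have F2: "F\<^sup>2 = \<rho>\<^sup>2" by auto
  have n: "n = \<alpha> * e\<^sub>1 + \<beta> * e\<^sub>2" using \<sigma>\<tau> by (auto simp: n_def d A B)
  have n': "n = \<delta>\<^sup>2 * \<alpha>\<^sup>2 + (\<beta> - F * \<alpha>)\<^sup>2"
    unfolding n e\<^sub>1_def e\<^sub>2_def H_def F2[symmetric] by algebra
  have \<alpha>\<beta>: "\<alpha> \<noteq> 0 \<or> \<beta> \<noteq> 0" using AB A B by auto
  have n0: "0 < n"
  proof (cases "\<alpha> = 0")
    case True
    then show ?thesis using \<alpha>\<beta> by (simp add: n')
  next
    case False
    then have "0 < \<delta>\<^sup>2 * \<alpha>\<^sup>2" using \<delta> by simp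
    then show ?thesis unfolding n' by (simp add: add_pos_nonneg)
  qed
  define h where "h = \<alpha> + \<beta> - b"
  have b: "b = \<alpha> + \<beta> - h" by (simp add: h_def)
  have fold': "\<bar>s - 2 * (\<alpha> * s + \<beta> * t - b) / n * e\<^sub>1\<bar> \<le> 1 \<and> \<bar>t - 2 * (\<alpha> * s + \<beta> * t - b) / n * e\<^sub>2\<bar> \<le> 1"
    if "\<bar>s\<bar> \<le> 1" "\<bar>t\<bar> \<le> 1" "b \<le> \<alpha> * s + \<beta> * t" for s t
  proof -
    have eq: "A * (\<sigma> * s) + B * (\<tau> * t) = \<alpha> * s + \<beta> * t" using \<sigma>\<tau> by (auto simp: A B)
    have "\<bar>\<sigma> * s\<bar> \<le> 1" "\<bar>\<tau> * t\<bar> \<le> 1" using that A B by (simp_all add: abs_mult)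
    from fold[OF this] that(3)
    have "\<bar>\<sigma> * s - 2 * (\<alpha> * s + \<beta> * t - b) / n * d\<^sub>1\<bar> \<le> 1 \<and> \<bar>\<tau> * t - 2 * (\<alpha> * s + \<beta> * t - b) / n * d\<^sub>2\<bar> \<le> 1"
      by (simp only: eq)
    moreover have "\<sigma> * s - 2 * (\<alpha> * s + \<beta> * t - b) / n * d\<^sub>1 = \<sigma> * (s - 2 * (\<alpha> * s + \<beta> * t - b) / n * e\<^sub>1)"
      "\<tau> * t - 2 * (\<alpha> * s + \<beta> * t - b) / n * d\<^sub>2 = \<tau> * (t - 2 * (\<alpha> * s + \<beta> * t - b) / n * e\<^sub>2)"
      unfolding d by algebra+
    ultimately show ?thesis using A(2) B(2) by (simp only: abs_mult mult_1)
  qed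
  let ?C = "cap square (vector [A, B]) b"
  have pos: "0 < 1 - \<rho> / 2 - 4 * \<delta>\<^sup>2" using \<delta> by simp
  \<comment> \<open>By the quadratic equation, \<open>2 * (1 - \<rho>)\<close> is the claimed bound
    at \<open>\<delta> = 0\<close>; the quadrilateral folds only have to meet this smaller
    one.\<close>
  have c: "2 * (1 - \<rho>) \<le> 1 / (1 - \<rho> / 2 - 4 * \<delta>\<^sup>2)"
  proof -
    have "(1 - \<rho>) * (2 - \<rho>) = 1" using \<rho>(3) by (simp add: power2_eq_square algebra_simps)
    moreover have "2 * (1 - \<rho>) * (1 - \<rho> / 2 - 4 * \<delta>\<^sup>2) = (1 - \<rho>) * (2 - \<rho>) - 8 * (1 - \<rho>) * \<delta>\<^sup>2"
      by (simp add: field_simps)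
    moreover have "0 \<le> 8 * (1 - \<rho>) * \<delta>\<^sup>2" using \<rho> by simp
    ultimately have "2 * (1 - \<rho>) * (1 - \<rho> / 2 - 4 * \<delta>\<^sup>2) \<le> 1" by linarith
    then show ?thesis using pos by (simp only: pos_le_divide_eq)
  qed
  show ?thesis
  proof (cases "h \<le> 0")
    case True
    have "?C \<subseteq> {x. vector [A, B] \<bullet> x = b}"
    proof
      fix x assume "x \<in> ?C"
      then have x: "\<bar>x$1\<bar> \<le> 1" "\<bar>x$2\<bar> \<le> 1" "b \<le> \<sigma> * \<alpha> * x$1 + \<tau> * \<beta> * x$2"
        by (auto simp: cap_def mem_square inner_vector2 A B)
      have "\<sigma> * x$1 \<le> 1" "\<tau> * x$2 \<le> 1" using x \<sigma>\<tau> by auto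
      from mult_left_mono[OF this(1) A(3)] mult_left_mono[OF this(2) B(3)] have "\<sigma> * \<alpha> * x$1 + \<tau> * \<beta> * x$2 \<le> \<alpha> + \<beta>" by (simp add: mult.assoc mult.left_commute)
      then show "x \<in> {x. vector [A, B] \<bullet> x = b}" using True x(3) by (simp add: b inner_vector2 A B)
    qed
    moreover have "(vector [A, B] :: real^2) \<noteq> 0" using AB by (auto simp: vec_eq_iff forall_2)
    ultimately have "negligible ?C" using negligible_hyperplane negligible_subset by blast
    then show ?thesis using pos by (simp add: negligible_imp_measure0)
  next
    case False
    then have h0: "0 < h" by simp
    \<comment> \<open>The image of the vertex \<open>(1, 1)\<close> has to stay in the
      square.\<close>
    have corner: "0 \<le> e\<^sub>1" "0 \<le> e\<^sub>2" "h * e\<^sub>1 \<le> n" "h * e\<^sub>2 \<le> n"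
    proof -
      have "\<bar>1 - 2 * h / n * e\<^sub>1\<bar> \<le> 1 \<and> \<bar>1 - 2 * h / n * e\<^sub>2\<bar> \<le> 1"
        using fold'[of 1 1] h0 by (simp add: h_def)
      then have "0 \<le> h / n * e\<^sub>1" "0 \<le> h / n * e\<^sub>2" "h / n * e\<^sub>1 \<le> 1" "h / n * e\<^sub>2 \<le> 1" by auto
      moreover have "0 < h / n" using h0 n0 by simp
      ultimately show "0 \<le> e\<^sub>1" "0 \<le> e\<^sub>2" "h * e\<^sub>1 \<le> n" "h * e\<^sub>2 \<le> n"
        using n0 h0 by (simp_all add: zero_le_mult_iff zero_le_divide_iff pos_divide_le_eq)
    qed
    \<comment> \<open>The cases distinguish whether the vertex \<open>(1, - 1)\<close> or
      \<open>(- 1, 1)\<close> is folded over as well, or neither of them.\<close>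
    consider "2 * \<beta> < h" | "2 * \<alpha> < h" | "h \<le> 2 * \<alpha>" "h \<le> 2 * \<beta>" by linarith
    then show ?thesis
    proof cases
      case 1
      \<comment> \<open>The second coordinate of the vertex \<open>(1, - 1)\<close> cannot decrease.
        Together with \<open>corner\<close> this leaves only folds orthogonal to the long
        side.\<close>
      have "e\<^sub>2 \<le> 0"
      proof -
        have eq: "\<alpha> * 1 + \<beta> * - 1 - b = h - 2 * \<beta>" by (simp add: h_def)
        with 1 have "b \<le> \<alpha> * 1 + \<beta> * - 1" by linarith
        from fold'[OF _ _ this, unfolded eq, THEN conjunct2]
        have "\<bar>- 1 - 2 * (h - 2 * \<beta>) / n * e\<^sub>2\<bar> \<le> 1" by (simp only: abs_minus abs_one order_refl)
        moreover have "2 * (h - 2 * \<beta>) / n * e\<^sub>2 = 2 * ((h - 2 * \<beta>) / n * e\<^sub>2)" by simp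
        ultimately have "\<bar>- 1 - 2 * ((h - 2 * \<beta>) / n * e\<^sub>2)\<bar> \<le> 1" by (simp only:)
        then have "0 \<le> - ((h - 2 * \<beta>) / n * e\<^sub>2)" by linarith
        moreover have "0 < (h - 2 * \<beta>) / n" using 1 n0 by simp
        ultimately show ?thesis using mult_pos_pos[of _ e\<^sub>2] by (metis neg_0_le_iff_le not_le)
      qed
      with corner have e2: "e\<^sub>2 = 0" by simp
      then have \<beta>: "\<beta> = F * \<alpha>" by (simp add: e\<^sub>2_def)
      with \<alpha>\<beta> A(3) have \<alpha>0: "0 < \<alpha>" by auto
      then have F: "F = \<rho>" using F \<beta> B(3) \<rho> by (auto simp: zero_le_mult_iff mult_le_0_iff)
      have "0 < e\<^sub>1" using n0 n e2 \<alpha>0 by (simp add: zero_less_mult_iff)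
      then have "h \<le> \<alpha>" using corner(3) n e2 by simp
      have "measure lebesgue ?C \<le> 2 * (h - \<beta>) / \<alpha>"
        unfolding A(1) B(1) b using A B \<alpha>0 1 by (intro side_cap_le) auto
      also have "\<dots> \<le> 2 * (1 - \<rho>)"
        unfolding pos_divide_le_eq[OF \<alpha>0] using \<open>h \<le> \<alpha>\<close> by (simp add: \<beta> F algebra_simps)
      finally show ?thesis using c by simp
    next
      case 2
      have "e\<^sub>1 \<le> 0"
      proof -
        have eq: "\<alpha> * - 1 + \<beta> * 1 - b = h - 2 * \<alpha>" by (simp add: h_def)
        with 2 have "b \<le> \<alpha> * - 1 + \<beta> * 1" by linarith
        from fold'[OF _ _ this, unfolded eq, THEN conjunct1]
        have "\<bar>- 1 - 2 * (h - 2 * \<alpha>) / n * e\<^sub>1\<bar> \<le> 1" by (simp only: abs_minus abs_one order_refl)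
        moreover have "2 * (h - 2 * \<alpha>) / n * e\<^sub>1 = 2 * ((h - 2 * \<alpha>) / n * e\<^sub>1)" by simp
        ultimately have "\<bar>- 1 - 2 * ((h - 2 * \<alpha>) / n * e\<^sub>1)\<bar> \<le> 1" by (simp only:)
        then have "0 \<le> - ((h - 2 * \<alpha>) / n * e\<^sub>1)" by linarith
        moreover have "0 < (h - 2 * \<alpha>) / n" using 2 n0 by simp
        ultimately show ?thesis using mult_pos_pos[of _ e\<^sub>1] by (metis neg_0_le_iff_le not_le)
      qed
      with corner have e1: "e\<^sub>1 = 0" by simp
      have H: "0 < H" "H < 2 * \<rho>"
      proof -
        have "0 < \<rho>\<^sup>2" using \<rho>(1) by simp
        then show "0 < H" unfolding H_def by (rule add_pos_nonneg) simp
        have "H \<le> \<rho> * (1 - \<rho>)" using \<delta>(2) by (simp add: H_def add.commute)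
        also have "\<dots> < \<rho> * 2" using \<rho>(1) by (intro mult_strict_left_mono) auto
        finally show "H < 2 * \<rho>" by simp
      qed
      have \<alpha>: "H * \<alpha> = F * \<beta>" using e1 by (simp add: e\<^sub>1_def)
      have \<beta>0: "0 < \<beta>" using \<alpha> \<alpha>\<beta> H B(3) by (cases "\<beta> = 0") auto
      have "0 < e\<^sub>2" using n0 n e1 \<beta>0 by (simp add: zero_less_mult_iff)
      then have "h \<le> \<beta>" using corner(4) n e1 by simp
      have "0 \<le> F" using \<alpha> \<beta>0 H A(3) by (metis mult_nonneg_nonneg less_imp_le zero_le_mult_iff not_less)
      then have "F = \<rho>" using F \<rho> by auto
      \<comment> \<open>A fold orthogonal to the short side would need \<open>H\<close> to be at
        least \<open>2 * \<rho>\<close>, unless \<open>\<alpha>\<close> and hence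
        \<open>\<beta>\<close> vanish.\<close>
      have "2 * \<rho> * \<alpha> \<le> \<rho> * \<beta>" using 2 \<open>h \<le> \<beta>\<close> \<rho> by simp
      moreover have "H * \<alpha> \<le> 2 * \<rho> * \<alpha>" using H A(3) by (intro mult_right_mono) auto
      moreover have "H * \<alpha> = \<rho> * \<beta>" using \<alpha> \<open>F = \<rho>\<close> by simp
      ultimately have "2 * \<rho> * \<alpha> = H * \<alpha>" by (intro antisym) (simp_all only:)
      then have "\<alpha> = 0" using H by simp
      then show ?thesis using \<alpha> \<open>F = \<rho>\<close> \<rho> \<beta>0 by simp
    next
      case 3
      then have \<alpha>\<beta>0: "0 < \<alpha>" "0 < \<beta>" using h0 by auto
      have le: "measure lebesgue ?C \<le> h\<^sup>2 / (2 * \<alpha> * \<beta>)"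
        unfolding A(1) B(1) b using A B \<alpha>\<beta>0 h0 by (intro corner_cap_le) auto
      define X Y where "X = \<alpha> / h" and "Y = \<beta> / h"
      have XY: "1 / 2 \<le> X" "1 / 2 \<le> Y" using 3 h0 by (simp_all add: X_def Y_def field_simps)
      have \<alpha>X: "\<alpha> = h * X" "\<beta> = h * Y" using h0 by (simp_all add: X_def Y_def)
      have le': "measure lebesgue ?C \<le> 1 / (2 * (X * Y))"
        using le h0 by (simp add: \<alpha>X power2_eq_square mult.assoc mult.left_commute)
      show ?thesis
      proof (cases "F = \<rho>")
        case True
        \<comment> \<open>For this sign, \<open>0 \<le> e\<^sub>1\<close> already makes
          \<open>X\<close> large: \<open>1 / 2 \<le> Y \<le> (1 - \<rho>) * X\<close>.\<close>
        have "h * (\<rho> * Y) \<le> h * (H * X)" using corner(1) by (simp add: e\<^sub>1_def True \<alpha>X algebra_simps)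
        then have "\<rho> * Y \<le> H * X" using h0 by simp
        also have "H * X \<le> \<rho> * (1 - \<rho>) * X" using \<delta> XY by (intro mult_right_mono) (auto simp: H_def)
        finally have "\<rho> * Y \<le> \<rho> * ((1 - \<rho>) * X)" by simp
        then have "Y \<le> (1 - \<rho>) * X" using \<rho> by simp
        then have "1 / 2 \<le> (1 - \<rho>) * X" using XY by simp
        then have "1 / 2 * (1 / 2) \<le> (1 - \<rho>) * X * Y" using XY by (intro mult_mono) auto
        then have "1 / (2 * (X * Y)) \<le> 2 * (1 - \<rho>)" using XY by (simp add: field_simps)
        then show ?thesis using le' c by linarith
      next
        case False
        with F have F: "F = - \<rho>" by simp
        have "h * (\<beta> + \<rho> * \<alpha>) \<le> \<delta>\<^sup>2 * \<alpha>\<^sup>2 + (\<beta> + \<rho> * \<alpha>)\<^sup>2"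
          using corner(4) by (simp add: e\<^sub>2_def n' F)
        then have "h\<^sup>2 * (Y + \<rho> * X) \<le> h\<^sup>2 * ((Y + \<rho> * X)\<^sup>2 + \<delta>\<^sup>2 * X\<^sup>2)"
          by (simp add: \<alpha>X power2_eq_square algebra_simps)
        then have "Y + \<rho> * X \<le> (Y + \<rho> * X)\<^sup>2 + \<delta>\<^sup>2 * X\<^sup>2" using h0 by simp
        from mult_left_mono[OF fold_product_ge[OF XY \<rho>(1,2) this], of 2]
        have "1 - \<rho> / 2 - 4 * \<delta>\<^sup>2 \<le> 2 * (X * Y)" by (simp add: diff_divide_distrib)
        then have "1 / (2 * (X * Y)) \<le> 1 / (1 - \<rho> / 2 - 4 * \<delta>\<^sup>2)" using pos by (intro divide_left_mono) auto
        then show ?thesis using le' by simp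
      qed
    qed
  qed
qed

section \<open>Parallelograms as sheared squares\<close>

text \<open>Maps \<open>square\<close>, whose sides have length 2, to the parallelogram centred at 0
  with sides twice \<open>(1, 0)\<close> and \<open>(\<rho>, \<delta>)\<close>.\<close>

definition shear :: "real \<Rightarrow> real \<Rightarrow> real^2 \<Rightarrow> real^2" where
  "shear \<rho> \<delta> x = vector [x$1 + \<rho> * x$2, \<delta> * x$2]"

lemma shear_nth [simp]: "shear \<rho> \<delta> x $ 1 = x$1 + \<rho> * x$2" "shear \<rho> \<delta> x $ 2 = \<delta> * x$2"
  by (simp_all add: shear_def)

lemma linear_shear: "linear (shear \<rho> \<delta>)"
  by (rule linearI) (simp_all add: vec_eq_iff forall_2 algebra_simps)

lemma inj_shear: "\<delta> \<noteq> 0 \<Longrightarrow> inj (shear \<rho> \<delta>)"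
  by (auto simp: inj_def vec_eq_iff forall_2)

lemma measure_shear:
  assumes "S \<in> lmeasurable"
  shows "measure lebesgue (shear \<rho> \<delta> ` S) = \<bar>\<delta>\<bar> * measure lebesgue S"
  using measure_linear_image[OF linear_shear assms]
  by (simp add: det_2 matrix_def axis_def)

lemma measure_square: "measure lebesgue square = 4"
  using measure_cbox_centred[of "1 :: real^2" 0] by simp

lemma parallelogram_shear:
  assumes "\<delta> \<noteq> 0"
  shows "parallelogram (shear \<rho> \<delta> ` square)"
proof -
  define p u v :: "real^2" where "p = vector [- 1 - \<rho>, - \<delta>]" and "u = vector [2, 0]" and "v = vector [2 * \<rho>, 2 * \<delta>]"
  have "\<not> collinear {0, u, v}"
    using assms by (auto simp: collinear_lemma u_def v_def vec_eq_iff forall_2)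
  moreover have "shear \<rho> \<delta> ` square = {p + s *\<^sub>R u + t *\<^sub>R v | s t. s \<in> {0..1} \<and> t \<in> {0..1}}"
  proof (intro equalityI subsetI)
    fix y assume "y \<in> shear \<rho> \<delta> ` square"
    then obtain x where x: "x \<in> square" "y = shear \<rho> \<delta> x" by blast
    then have "y = p + ((x$1 + 1) / 2) *\<^sub>R u + ((x$2 + 1) / 2) *\<^sub>R v"
      by (simp add: p_def u_def v_def vec_eq_iff forall_2 field_simps)
    moreover have "(x$1 + 1) / 2 \<in> {0..1}" "(x$2 + 1) / 2 \<in> {0..1}" using x(1) by (auto simp: mem_square)
    ultimately show "y \<in> {p + s *\<^sub>R u + t *\<^sub>R v | s t. s \<in> {0..1} \<and> t \<in> {0..1}}" by blast
  next
    fix y assume "y \<in> {p + s *\<^sub>R u + t *\<^sub>R v | s t. s \<in> {0..1} \<and> t \<in> {0..1}}"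
    then obtain s t where st: "y = p + s *\<^sub>R u + t *\<^sub>R v" "s \<in> {0..1}" "t \<in> {0..1}" by blast
    let ?x = "vector [2 * s - 1, 2 * t - 1] :: real^2"
    have "?x \<in> square" using st by (auto simp: mem_square)
    moreover have "y = shear \<rho> \<delta> ?x"
      by (simp add: st p_def u_def v_def vec_eq_iff forall_2 algebra_simps)
    ultimately show "y \<in> shear \<rho> \<delta> ` square" by blast
  qed
  ultimately show ?thesis unfolding parallelogram_def by blast
qed

lemma convex_body_shear:
  assumes "\<delta> \<noteq> 0"
  shows "convex_body (shear \<rho> \<delta> ` square)"
proof -
  have c: "compact (shear \<rho> \<delta> ` square)"
    using linear_shear by (intro compact_continuous_image linear_continuous_on compact_cbox)
      (simp add: linear_conv_bounded_linear)
  have v: "convex (shear \<rho> \<delta> ` square)"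
    by (intro convex_linear_image linear_shear convex_box)
  have "measure lebesgue (shear \<rho> \<delta> ` square) \<noteq> 0"
    using assms by (simp add: measure_shear measure_square)
  then have "interior (shear \<rho> \<delta> ` square) \<noteq> {}"
    using negligible_convex_interior[OF v] negligible_imp_measure0 by blast
  with c v show ?thesis by (simp add: convex_body_def)
qed

lemma shear_cap:
  fixes a :: "real^2"
  shows "shear \<rho> \<delta> ` square \<inter> closed_halfspace a b =
    shear \<rho> \<delta> ` cap square (vector [- a$1, - (\<rho> * a$1 + \<delta> * a$2)]) (- b)"
proof -
  have "a \<bullet> shear \<rho> \<delta> x \<le> b \<longleftrightarrow> - b \<le> vector [- a$1, - (\<rho> * a$1 + \<delta> * a$2)] \<bullet> x" for x
    unfolding inner_vector2 inner_vec_def sum_2 by (simp add: algebra_simps)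
  then show ?thesis by (auto simp: closed_halfspace_def cap_def)
qed

text \<open>In square coordinates the reflection becomes oblique, with direction
  \<open>(d\<^sub>1, d\<^sub>2)\<close>. The shear takes this vector to \<open>a\<close> scaled by
  \<open>- (\<delta>\<^sup>2)\<close>, and the denominator of \<open>l\<close> is
  \<open>\<delta>\<^sup>2 * (a \<bullet> a)\<close>, so the powers of \<open>\<delta>\<close>
  cancel.\<close>

lemma shear_refl_hyp:
  fixes a x :: "real^2" and \<rho> \<delta> b :: real
  defines "A \<equiv> - a$1" and "B \<equiv> - (\<rho> * a$1 + \<delta> * a$2)"
  defines "d\<^sub>1 \<equiv> (\<rho>\<^sup>2 + \<delta>\<^sup>2) * A - \<rho> * B" and "d\<^sub>2 \<equiv> B - \<rho> * A"
  assumes "\<delta> \<noteq> 0" "a \<noteq> 0"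
  defines "l \<equiv> 2 * (A * x$1 + B * x$2 + b) / (A * d\<^sub>1 + B * d\<^sub>2)"
  shows "refl_hyp a b (shear \<rho> \<delta> x) = shear \<rho> \<delta> (vector [x$1 - l * d\<^sub>1, x$2 - l * d\<^sub>2])"
proof -
  have aa: "a \<bullet> a \<noteq> 0" using assms by simp
  have n: "A * d\<^sub>1 + B * d\<^sub>2 = \<delta>\<^sup>2 * (a \<bullet> a)"
    unfolding d\<^sub>1_def d\<^sub>2_def A_def B_def inner_vec_def sum_2 inner_real_def by algebra
  have r: "a \<bullet> shear \<rho> \<delta> x - b = - (A * x$1 + B * x$2 + b)"
    unfolding A_def B_def inner_vec_def sum_2 by (simp add: algebra_simps)
  have d: "d\<^sub>1 + \<rho> * d\<^sub>2 = - (\<delta>\<^sup>2) * a$1" "\<delta> * d\<^sub>2 = - (\<delta>\<^sup>2) * a$2"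
    unfolding d\<^sub>1_def d\<^sub>2_def A_def B_def by algebra+
  define q where "q = 2 * (A * x$1 + B * x$2 + b) / (a \<bullet> a)"
  have l: "l * \<delta>\<^sup>2 = q" unfolding l_def n q_def using \<open>\<delta> \<noteq> 0\<close> by simp
  have "refl_hyp a b (shear \<rho> \<delta> x) = shear \<rho> \<delta> x + q *\<^sub>R a"
    unfolding refl_hyp_def r q_def
    by (simp only: mult_minus_right minus_divide_left[symmetric] scaleR_minus_left diff_minus_eq_add)
  also have "\<dots> = shear \<rho> \<delta> (vector [x$1 - l * d\<^sub>1, x$2 - l * d\<^sub>2])"
  proof -
    have "x$1 - l * d\<^sub>1 + \<rho> * (x$2 - l * d\<^sub>2) = x$1 + \<rho> * x$2 - l * (d\<^sub>1 + \<rho> * d\<^sub>2)"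
      "\<delta> * (x$2 - l * d\<^sub>2) = \<delta> * x$2 - l * (\<delta> * d\<^sub>2)" by algebra+
    then show ?thesis unfolding d by (simp add: vec_eq_iff forall_2 l[symmetric] algebra_simps)
  qed
  finally show ?thesis .
qed

text \<open>Folding along the perpendicular bisector of the upper long side: that line is
  \<open>x\<^sub>1 = \<rho>\<close> and cuts off the fraction
  \<open>(1 - \<rho>) / 2\<close>.\<close>

lemma sym_fold_shear_ge:
  assumes \<rho>: "0 < \<rho>" "\<rho> \<le> 1 / 2" and \<delta>: "\<delta> \<noteq> 0"
  shows "1 - \<rho> \<le> sym_fold (shear \<rho> \<delta> ` square)"
proof (rule sym_fold_ge)
  let ?P = "shear \<rho> \<delta> ` square"
  define a :: "real^2" where "a = vector [- 1, 0]"
  show "compact ?P" "0 < measure lebesgue ?P"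
    using convex_body_shear[OF \<delta>] convex_body_measure_pos by (auto simp: convex_body_def)
  show "a \<noteq> 0" by (simp add: a_def vec_eq_iff forall_2)
  have eq: "?P \<inter> closed_halfspace a (- \<rho>) = shear \<rho> \<delta> ` cap square (vector [1, \<rho>]) \<rho>"
    by (simp add: shear_cap a_def)
  show "refl_hyp a (- \<rho>) ` (?P \<inter> closed_halfspace a (- \<rho>)) \<subseteq> ?P"
  proof
    fix y assume "y \<in> refl_hyp a (- \<rho>) ` (?P \<inter> closed_halfspace a (- \<rho>))"
    then obtain x where x: "x \<in> cap square (vector [1, \<rho>]) \<rho>" and y: "y = refl_hyp a (- \<rho>) (shear \<rho> \<delta> x)"
      unfolding eq by blast
    let ?z = "vector [2 * \<rho> * (1 - x$2) - x$1, x$2] :: real^2"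
    have "y = shear \<rho> \<delta> ?z"
      by (simp add: y refl_hyp_def a_def inner_vector2 vec_eq_iff forall_2 algebra_simps)
    moreover have "?z \<in> square"
    proof -
      have x': "\<bar>x$1\<bar> \<le> 1" "\<bar>x$2\<bar> \<le> 1" "\<rho> \<le> x$1 + \<rho> * x$2"
        using x by (auto simp: cap_def mem_square inner_vector2)
      have "0 \<le> \<rho> * (1 - x$2)" using x' \<rho> by simp
      moreover have "\<rho> * (1 - x$2) \<le> 1 / 2 * 2" using x' \<rho> by (intro mult_mono) auto
      ultimately show ?thesis using x' by (simp add: mem_square abs_le_iff algebra_simps)
    qed
    ultimately show "y \<in> ?P" by blast
  qed
  show "(1 - \<rho>) * measure lebesgue ?P \<le> 2 * measure lebesgue (?P \<inter> closed_halfspace a (- \<rho>))"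
  proof -
    \<comment> \<open>Half of this box, which is centred on the line and contained in the square,
      bounds the folded area from below.\<close>
    define m k g :: "real^2" where "m = vector [\<rho>, 0]" and "k = vector [1 - \<rho>, 1]" and "g = vector [1, \<rho>]"
    have g0: "g \<noteq> 0" by (simp add: g_def vec_eq_iff forall_2)
    have gm: "g \<bullet> m = \<rho>" by (simp add: g_def m_def inner_vector2)
    have k0: "0 \<le> k$1" "0 \<le> k$2" using \<rho> by (simp_all add: k_def)
    have "cap (cbox (m - k) (m + k)) g (g \<bullet> m) \<subseteq> cap square g \<rho>"
      unfolding gm using \<rho> by (auto simp: cap_def mem_square mem_cbox_centred m_def k_def abs_le_iff)
    then have "measure lebesgue (cap (cbox (m - k) (m + k)) g (g \<bullet> m)) \<le> measure lebesgue (cap square g \<rho>)"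
      by (intro measure_mono_fmeasurable) (simp_all add: fmeasurableD)
    then have "2 * (1 - \<rho>) \<le> measure lebesgue (cap square g \<rho>)"
      by (simp add: measure_half_cbox[OF g0] measure_cbox_centred[OF k0]) (simp add: k_def)
    then have "\<bar>\<delta>\<bar> * (2 * (1 - \<rho>)) \<le> \<bar>\<delta>\<bar> * measure lebesgue (cap square g \<rho>)"
      by (rule mult_left_mono) simp
    then show ?thesis
      by (simp add: eq measure_shear measure_square g_def[symmetric] algebra_simps)
  qed
qed

lemma sym_fold_shear_le:
  assumes \<rho>: "0 < \<rho>" "\<rho> \<le> 1 / 2" "\<rho>\<^sup>2 = 3 * \<rho> - 1" and \<delta>: "0 < \<delta>" "\<delta>\<^sup>2 + \<rho>\<^sup>2 \<le> \<rho> * (1 - \<rho>)" "4 * \<delta>\<^sup>2 < 1 - \<rho> / 2"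
  shows "sym_fold (shear \<rho> \<delta> ` square) \<le> 1 / (2 - \<rho> - 8 * \<delta>\<^sup>2)"
proof -
  let ?P = "shear \<rho> \<delta> ` square"
  let ?M = "{measure lebesgue (?P \<inter> closed_halfspace a b) | a b.
    a \<noteq> 0 \<and> refl_hyp a b ` (?P \<inter> closed_halfspace a b) \<subseteq> ?P}"
  let ?c = "1 / (1 - \<rho> / 2 - 4 * \<delta>\<^sup>2)"
  have \<delta>0: "\<delta> \<noteq> 0" using \<delta> by simp
  have "Sup ?M \<le> \<delta> * ?c"
  proof (rule cSup_least)
    \<comment> \<open>A halfspace missing the parallelogram is trivially a fold, so the supremum is
      over a nonempty set.\<close>
    define a :: "real^2" where "a = vector [1, 0]"
    have "- 1 * x$1 + - \<rho> * x$2 < 3" if "x \<in> square" for x :: "real^2"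
    proof -
      have "\<bar>\<rho> * x$2\<bar> \<le> 1 / 2 * 1"
        unfolding abs_mult using that \<rho> by (intro mult_mono) (auto simp: mem_square)
      moreover have "\<bar>x$1\<bar> \<le> 1" using that by (simp add: mem_square)
      ultimately have "- x$1 - \<rho> * x$2 < 3" by linarith
      then show ?thesis by simp
    qed
    then have "cap square (vector [- a$1, - (\<rho> * a$1 + \<delta> * a$2)]) (- (- 3)) = {}"
      by (force simp: cap_def inner_vector2 a_def)
    then have "?P \<inter> closed_halfspace a (- 3) = {}" by (simp add: shear_cap)
    moreover have "a \<noteq> 0" by (simp add: a_def vec_eq_iff forall_2)
    ultimately have "measure lebesgue (?P \<inter> closed_halfspace a (- 3)) \<in> ?M" by blast
    then show "?M \<noteq> {}" by blast
  next
    fix y assume "y \<in> ?M"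
    then obtain a b where y: "y = measure lebesgue (?P \<inter> closed_halfspace a b)" and a: "a \<noteq> 0"
      and fold: "refl_hyp a b ` (?P \<inter> closed_halfspace a b) \<subseteq> ?P" by blast
    define A B where "A = - a$1" and "B = - (\<rho> * a$1 + \<delta> * a$2)"
    define d\<^sub>1 d\<^sub>2 where "d\<^sub>1 = (\<rho>\<^sup>2 + \<delta>\<^sup>2) * A - \<rho> * B" and "d\<^sub>2 = B - \<rho> * A"
    define n where "n = A * d\<^sub>1 + B * d\<^sub>2"
    have "measure lebesgue (cap square (vector [A, B]) (- b)) \<le> ?c"
    proof (rule measure_square_fold_le[OF \<rho> \<delta>])
      show "A \<noteq> 0 \<or> B \<noteq> 0" using a \<delta>0 by (auto simp: A_def B_def vec_eq_iff forall_2)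
      fix x\<^sub>1 x\<^sub>2 :: real assume x: "\<bar>x\<^sub>1\<bar> \<le> 1" "\<bar>x\<^sub>2\<bar> \<le> 1" "- b \<le> A * x\<^sub>1 + B * x\<^sub>2"
      define x :: "real^2" where "x = vector [x\<^sub>1, x\<^sub>2]"
      have "x \<in> cap square (vector [A, B]) (- b)"
        using x by (simp add: cap_def mem_square inner_vector2 x_def)
      then have "refl_hyp a b (shear \<rho> \<delta> x) \<in> ?P"
        using fold by (auto simp: shear_cap A_def B_def)
      then have "shear \<rho> \<delta> (vector [x$1 - 2 * (A * x$1 + B * x$2 + b) / n * d\<^sub>1,
          x$2 - 2 * (A * x$1 + B * x$2 + b) / n * d\<^sub>2]) \<in> ?P"
        using shear_refl_hyp[OF \<delta>0 a, where b = b and x = x and \<rho> = \<rho>]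
        unfolding A_def[symmetric] B_def[symmetric] d\<^sub>1_def[symmetric] d\<^sub>2_def[symmetric] n_def[symmetric] by simp
      then have "vector [x$1 - 2 * (A * x$1 + B * x$2 + b) / n * d\<^sub>1,
          x$2 - 2 * (A * x$1 + B * x$2 + b) / n * d\<^sub>2] \<in> square"
        using inj_image_mem_iff[OF inj_shear[OF \<delta>0]] by blast
      then have "\<bar>x\<^sub>1 - 2 * (A * x\<^sub>1 + B * x\<^sub>2 - - b) / n * d\<^sub>1\<bar> \<le> 1 \<and>
          \<bar>x\<^sub>2 - 2 * (A * x\<^sub>1 + B * x\<^sub>2 - - b) / n * d\<^sub>2\<bar> \<le> 1"
        unfolding mem_square by (simp add: x_def)
      then show "\<bar>x\<^sub>1 - 2 * (A * x\<^sub>1 + B * x\<^sub>2 - - b) / (A * ((\<rho>\<^sup>2 + \<delta>\<^sup>2) * A - \<rho> * B) + B * (B - \<rho> * A)) * ((\<rho>\<^sup>2 + \<delta>\<^sup>2) * A - \<rho> * B)\<bar> \<le> 1 \<and>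
          \<bar>x\<^sub>2 - 2 * (A * x\<^sub>1 + B * x\<^sub>2 - - b) / (A * ((\<rho>\<^sup>2 + \<delta>\<^sup>2) * A - \<rho> * B) + B * (B - \<rho> * A)) * (B - \<rho> * A)\<bar> \<le> 1"
        unfolding n_def d\<^sub>1_def d\<^sub>2_def .
    qed
    then have "\<delta> * measure lebesgue (cap square (vector [A, B]) (- b)) \<le> \<delta> * ?c"
      using \<delta>(1) by (intro mult_left_mono) auto
    then show "y \<le> \<delta> * ?c"
      using \<delta>(1) by (simp add: y shear_cap measure_shear A_def B_def)
  qed
  then have "2 / (4 * \<delta>) * Sup ?M \<le> 2 / (4 * \<delta>) * (\<delta> * ?c)"
    using \<delta>(1) by (intro mult_left_mono) auto
  moreover have "measure lebesgue ?P = 4 * \<delta>" using \<delta>(1) by (simp add: measure_shear measure_square)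
  ultimately have "sym_fold ?P \<le> 2 / (4 * \<delta>) * (\<delta> * ?c)" unfolding sym_fold_def by (simp only:)
  also have "\<dots> = 1 / (2 * (1 - \<rho> / 2 - 4 * \<delta>\<^sup>2))" using \<delta>(1) by simp
  finally show ?thesis by (simp add: algebra_simps)
qed

text \<open>With \<open>\<rho> = (3 - sqrt 5) / 2\<close> the lower bound \<open>1 - \<rho>\<close>
  is \<open>1 / golden_ratio\<close> for every \<open>\<delta>\<close>, and the upper bound tends to
  the same value as \<open>\<delta>\<close> tends to 0.\<close>

lemma sym_fold_parallelograms:
  obtains P :: "nat \<Rightarrow> (real^2) set" where "\<And>j. parallelogram (P j)" "\<And>j. convex_body (P j)"
    "(\<lambda>j. sym_fold (P j)) \<longlonglongrightarrow> 1 / golden_ratio"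
proof -
  define \<rho> :: real where "\<rho> = (3 - sqrt 5) / 2"
  \<comment> \<open>Starting at 1/10 makes \<open>\<delta>\<^sup>2\<close> at most 1/100, small
    enough for the side conditions of \<open>sym_fold_shear_le\<close> at every index.\<close>
  define \<delta> :: "nat \<Rightarrow> real" where "\<delta> j = 1 / real (j + 10)" for j
  define P where "P j = shear \<rho> (\<delta> j) ` square" for j
  have sqrt5: "2236 / 1000 < sqrt 5" "sqrt 5 < 2240 / 1000"
    by (intro real_less_rsqrt real_less_lsqrt; simp add: power2_eq_square)+
  have \<rho>: "0 < \<rho>" "\<rho> \<le> 1 / 2" "38 / 100 \<le> \<rho>" "\<rho> \<le> 382 / 1000" using sqrt5 by (simp_all add: \<rho>_def)
  have \<rho>2: "\<rho>\<^sup>2 = 3 * \<rho> - 1" by (simp add: \<rho>_def power2_eq_square field_simps)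
  have golden: "2 - \<rho> = golden_ratio" "1 - \<rho> = 1 / golden_ratio"
  proof -
    show eq: "2 - \<rho> = golden_ratio" unfolding \<rho>_def golden_ratio_def by (simp add: field_simps)
    have "(1 - \<rho>) * (2 - \<rho>) = 1" using \<rho>2 by (simp add: power2_eq_square algebra_simps)
    then show "1 - \<rho> = 1 / golden_ratio" unfolding eq using eq \<rho>(2) by (subst nonzero_eq_divide_eq) auto
  qed
  have \<delta>: "0 < \<delta> j" "(\<delta> j)\<^sup>2 \<le> 1 / 100" for j
  proof -
    show "0 < \<delta> j" by (simp add: \<delta>_def)
    moreover have "\<delta> j \<le> 1 / 10" unfolding \<delta>_def by (intro divide_left_mono) auto
    ultimately have "(\<delta> j)\<^sup>2 \<le> (1 / 10)\<^sup>2" by (intro power_mono) auto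
    then show "(\<delta> j)\<^sup>2 \<le> 1 / 100" by (simp add: power2_eq_square)
  qed
  have \<delta>': "(\<delta> j)\<^sup>2 + \<rho>\<^sup>2 \<le> \<rho> * (1 - \<rho>)" "4 * (\<delta> j)\<^sup>2 < 1 - \<rho> / 2" for j
  proof -
    have "\<rho> * (1 - \<rho>) = \<rho> - \<rho>\<^sup>2" by (simp add: right_diff_distrib power2_eq_square)
    then show "(\<delta> j)\<^sup>2 + \<rho>\<^sup>2 \<le> \<rho> * (1 - \<rho>)" using \<delta>(2)[of j] \<rho> \<rho>2 by linarith
    show "4 * (\<delta> j)\<^sup>2 < 1 - \<rho> / 2" using \<delta>(2)[of j] \<rho> by linarith
  qed
  have lower: "1 / golden_ratio \<le> sym_fold (P j)" for j
    unfolding P_def golden(2)[symmetric] using \<delta>(1)[of j] by (intro sym_fold_shear_ge \<rho>) simp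
  have upper: "sym_fold (P j) \<le> 1 / (golden_ratio - 8 * (\<delta> j)\<^sup>2)" for j
    unfolding P_def golden(1)[symmetric] by (intro sym_fold_shear_le \<rho> \<rho>2 \<delta> \<delta>')
  have "\<delta> \<longlonglongrightarrow> 0"
    using LIMSEQ_ignore_initial_segment[OF lim_1_over_n, of 10] by (simp only: \<delta>_def[abs_def])
  then have "(\<lambda>j. 1 / (golden_ratio - 8 * (\<delta> j)\<^sup>2)) \<longlonglongrightarrow> 1 / (golden_ratio - 8 * 0\<^sup>2)"
  proof (intro tendsto_divide[OF tendsto_const] tendsto_diff[OF tendsto_const] tendsto_mult[OF tendsto_const] tendsto_power)
    show "golden_ratio - 8 * 0\<^sup>2 \<noteq> 0" using golden(1) \<rho>(2) by simp
  qed
  then have "(\<lambda>j. 1 / (golden_ratio - 8 * (\<delta> j)\<^sup>2)) \<longlonglongrightarrow> 1 / golden_ratio" by simp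
  then have "(\<lambda>j. sym_fold (P j)) \<longlonglongrightarrow> 1 / golden_ratio"
    by (rule tendsto_sandwich[OF always_eventually[rule_format, OF lower] always_eventually[rule_format, OF upper] tendsto_const])
  moreover have "parallelogram (P j)" "convex_body (P j)" for j
    unfolding P_def using less_imp_neq[OF \<delta>(1)[of j]] parallelogram_shear convex_body_shear by metis+
  ultimately show ?thesis by (intro that)
qed

section \<open>Assembling the bounds on both infima\<close>

theorem theorem1p3:
  shows "(\<forall>K :: (real^2) set. convex_body K \<longrightarrow> sym_fold K \<ge> 3/8)
    \<and> (\<exists>P :: nat \<Rightarrow> (real^2) set. (\<forall>j. parallelogram (P j))
          \<and> (\<lambda>j. sym_fold (P j)) \<longlonglongrightarrow> 1 / golden_ratio)
    \<and> 3/8 \<le> phi2 \<and> phi2 \<le> 1 / golden_ratio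
    \<and> (\<forall>K :: (real^2) set. convex_body K \<and> centrally_symmetric K \<longrightarrow> sym_fold K \<ge> 4/9)
    \<and> phi_cs2 \<ge> 4/9"
proof -
  obtain P :: "nat \<Rightarrow> (real^2) set" where P: "\<And>j. parallelogram (P j)" "\<And>j. convex_body (P j)"
    and lim: "(\<lambda>j. sym_fold (P j)) \<longlonglongrightarrow> 1 / golden_ratio"
    by (rule sym_fold_parallelograms) (rule that)
  have "3 / 8 \<le> phi2"
    unfolding phi2_def using P(2) sym_fold_ge_3_8 by (intro cInf_greatest) auto
  moreover have "phi2 \<le> 1 / golden_ratio"
  proof (rule LIMSEQ_le_const[OF lim])
    have "phi2 \<le> sym_fold (P j)" for j
      unfolding phi2_def using P(2) sym_fold_ge_3_8
      by (intro cInf_lower bdd_belowI[of _ "3 / 8"]) auto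
    then show "\<exists>N. \<forall>j\<ge>N. phi2 \<le> sym_fold (P j)" by blast
  qed
  moreover have "4 / 9 \<le> phi_cs2"
  proof -
    \<comment> \<open>The square itself, as \<open>shear 0 1\<close> is the identity, shows that the
      infimum is over a nonempty set.\<close>
    have "convex_body (shear 0 1 ` square)" by (rule convex_body_shear) simp
    moreover have "centrally_symmetric (shear 0 1 ` square)"
      unfolding centrally_symmetric_def
    proof (intro exI[of _ 0] ballI)
      fix y assume "y \<in> shear 0 1 ` square"
      then obtain x where "x \<in> square" "y = shear 0 1 x" by blast
      then have "- x \<in> square" "2 *\<^sub>R 0 - y = shear 0 1 (- x)"
        by (simp_all add: mem_square linear_neg[OF linear_shear])
      then show "2 *\<^sub>R 0 - y \<in> shear 0 1 ` square" by (simp only: image_eqI)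
    qed
    ultimately show ?thesis
      unfolding phi_cs2_def using sym_fold_ge_4_9 by (intro cInf_greatest) auto
  qed
  ultimately show ?thesis using P(1) lim by (intro conjI allI impI exI[of _ P] sym_fold_ge_3_8 sym_fold_ge_4_9) auto
qed

end
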